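(* Let $q\equiv1\pmod4$ be a prime power, $n\ge3$ odd, $\beta\in\mathbb{F}_q^*$ and $Q=(q^n-1)/(q-1)$. Write the product of the distinct prime divisors of $q^n-1$ as $k\,p_1\cdots p_s$, where $s\ge0$ and $p_1,\dots,p_s$ are distinct primes not dividing $k$, ordered so that $p_i\mid Q$ for $1\le i\le r$ and $p_i\nmid Q$ for $r<i\le s$. Let $\delta=1-\sum_{i=1}^s 1/p_i$ (with $\delta=1$ if $s=0$), $\delta_Q=1-\sum_{i=1}^r1/p_i$, and let $k_Q$ be the product of the primes dividing $k$ that divide $Q$. Assume $\delta>0$ and $$q^{\frac{n-1}{2}}>2\sqrt2\Big(\frac{s-1}{\delta}+2\Big)W(k)-\sqrt2\Big(\frac{r-1+\delta_Q}{\delta}+1\Big)W(k_Q).$$ Then $\mathcal{N}_\beta(q^n-1)>0$.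
   Context: For a divisor $m$ of $q^n-1$, an element $\xi\in\mathbb{F}_{q^n}^*$ is $m$-free if $\xi=\zeta^d$ with $d\mid m$ and $\zeta\in\mathbb{F}_{q^n}^*$ implies $d=1$. $\mathcal{N}_\beta(m)$ is the number of $m$-free $\xi\in\mathbb{F}_{q^n}^*$ with $\mathrm{Tr}(\xi^2)=\beta$, where $\mathrm{Tr}(\xi)=\sum_{i=0}^{n-1}\xi^{q^i}$. $W(t)$ is the number of square-free divisors of $t$. *)

theory Defs
  imports
    Complex_Main
    "HOL-Library.Cardinality"
    "HOL-Computational_Algebra.Computational_Algebra"
    "HOL-Number_Theory.Number_Theory"
begin

definition is_subfield :: "'a::field set \<Rightarrow> bool" where
  "is_subfield F \<longleftrightarrow>
     0 \<in> F \<and> 1 \<in> F \<and>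
     (\<forall>x\<in>F. \<forall>y\<in>F. x + y \<in> F \<and> x * y \<in> F) \<and>
     (\<forall>x\<in>F. - x \<in> F \<and> inverse x \<in> F)"

definition m_free :: "nat \<Rightarrow> 'a::field \<Rightarrow> bool" where
  "m_free m \<xi> \<longleftrightarrow>
     \<xi> \<noteq> 0 \<and> (\<forall>d \<zeta>. d dvd m \<and> \<zeta> \<noteq> 0 \<and> \<xi> = \<zeta> ^ d \<longrightarrow> d = 1)"

definition field_trace :: "nat \<Rightarrow> nat \<Rightarrow> 'a::field \<Rightarrow> 'a" where
  "field_trace q n \<xi> = (\<Sum>i<n. \<xi> ^ (q ^ i))"

text \<open>Here \<open>'a\<close> plays the role of the field with \<open>q ^ n\<close> elements.\<close>

definition N_free :: "nat \<Rightarrow> nat \<Rightarrow> 'a::{field,finite} \<Rightarrow> nat \<Rightarrow> nat" where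
  "N_free q n \<beta> m = card {\<xi>::'a. m_free m \<xi> \<and> field_trace q n (\<xi>\<^sup>2) = \<beta>}"

definition W_sqfree :: "nat \<Rightarrow> nat" where
  "W_sqfree t = card {d. d dvd t \<and> squarefree d}"

end

theory Submission imports Defs begin

text \<open>
  For an even exponent \<open>j\<close>, the sum of the multiplicative character \<open>\<chi>\<^sup>j\<close> over \<open>Tr (\<xi>\<^sup>2) = \<beta>\<close> splits as
  \<open>T (j/2) + T (j/2 + L/2)\<close>, where \<open>L = q ^ n - 1\<close> and \<open>T i\<close> is the sum of \<open>\<chi>\<^sup>i\<close> over
  \<open>Tr y = \<beta>\<close>; all characters of squarefree order have even exponent because \<open>4\<close> divides \<open>L\<close>.
  A second moment over the fibres of the trace gives \<open>|T i| \<le> X = q ^ ((n - 1) / 2)\<close> for nontrivial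
  characters and \<open>|T i| = X / \<surd>q\<close> for those trivial on the subfield. As \<open>Q\<close> is odd, one of the two
  halves of a character trivial on the subfield is again trivial there, so the sums are bounded by
  \<open>2 X\<close> in general and by \<open>(1 + 1 / \<surd>q) X\<close> for orders dividing \<open>Q\<close>. Inserting primes one at a time
  turns this into an estimate for the number of free elements, and the prime sieve finishes the proof.
  For \<open>q \<ge> 9\<close> the resulting criterion is implied by the assumed inequality; for \<open>q = 5\<close> it holds
  unconditionally once \<open>n \<ge> 5\<close>.
\<close>

section \<open>Finite fields and discrete logarithms\<close>

text \<open>Multiplication by \<open>x\<close> permutes \<open>G\<close>, so the product over
  \<open>G\<close> can be cancelled. Taking \<open>G\<close> to be all nonzero elements yields the
  exponent \<open>L\<close>, and \<open>G = F - {0}\<close> yields \<open>q - 1\<close>.\<close>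

lemma power_card_eq_1_of_mult_closed:
  fixes G :: "'a::field set"
  assumes "finite G" "0 \<notin> G" "x \<noteq> 0" "\<And>y. y \<in> G \<Longrightarrow> x * y \<in> G"
  shows "x ^ card G = 1"
proof -
  have inj: "inj_on ((*) x) G"
    using assms(3) by (auto simp: inj_on_def)
  have im: "(*) x ` G = G"
    using assms inj by (intro endo_inj_surj) auto
  have "\<Prod>G = (\<Prod>y\<in>(*) x ` G. y)"
    by (simp add: im)
  also have "\<dots> = (\<Prod>y\<in>G. x * y)"
    using inj by (simp add: prod.reindex)
  also have "\<dots> = x ^ card G * \<Prod>G"
    by (simp add: prod.distrib)
  finally show ?thesis
    using assms(1,2) by simp
qed

lemma freshmans_dream_CHAR_power:
  fixes x y :: "'a::comm_ring_1"
  assumes "prime CHAR('a)"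
  shows "(x + y) ^ (CHAR('a) ^ e) = x ^ (CHAR('a) ^ e) + y ^ (CHAR('a) ^ e)"
proof -
  let ?p = "CHAR('a)"
  have step: "(u + v) ^ ?p = u ^ ?p + v ^ ?p" for u v :: 'a
  proof -
    have p0: "?p > 0"
      using assms prime_gt_0_nat by blast
    have "(u + v) ^ ?p = (\<Sum>i\<le>?p. of_nat (?p choose i) * u ^ i * v ^ (?p - i))"
      by (rule binomial_ring)
    also have "\<dots> = (\<Sum>i\<in>{0, ?p}. of_nat (?p choose i) * u ^ i * v ^ (?p - i))"
    proof (rule sum.mono_neutral_right)
      show "\<forall>i\<in>{..?p} - {0, ?p}. of_nat (?p choose i) * u ^ i * v ^ (?p - i) = 0"
      proof
        fix i assume "i \<in> {..?p} - {0, ?p}"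
        then have "?p dvd (?p choose i)"
          using assms p0 by (intro dvd_choose_prime) auto
        then have "of_nat (?p choose i) = (0::'a)"
          by (simp add: of_nat_eq_0_iff_char_dvd)
        then show "of_nat (?p choose i) * u ^ i * v ^ (?p - i) = 0"
          by simp
      qed
    qed auto
    also have "\<dots> = u ^ ?p + v ^ ?p"
      using p0 by simp
    finally show ?thesis .
  qed
  show ?thesis
    by (induction e) (simp_all add: power_mult step mult.commute[of ?p])
qed

text \<open>The type class field is repackaged as a record \<open>R\<close>, so that the cyclicity
  theorem for finite fields given as records applies.\<close>

lemma finite_field_has_generator:
  "\<exists>g::'a::{field,finite}. g \<noteq> 0 \<and> (\<forall>x. x \<noteq> 0 \<longrightarrow> (\<exists>i. x = g ^ i))"
proof -
  define R where "R = \<lparr>carrier = (UNIV :: 'a set), monoid.mult = (*), one = (1::'a),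
    ring.zero = (0::'a), ring.add = (+)\<rparr>"
  have "cring R"
  proof (rule cringI)
    show "abelian_group R"
    proof (rule abelian_groupI)
      fix x assume "x \<in> carrier R"
      show "\<exists>y\<in>carrier R. y \<oplus>\<^bsub>R\<^esub> x = \<zero>\<^bsub>R\<^esub>"
        by (intro bexI[of _ "- x"]) (auto simp: R_def)
    qed (auto simp: R_def add_ac)
    show "Group.comm_monoid R"
      by (rule comm_monoidI) (auto simp: R_def mult_ac)
  qed (auto simp: R_def algebra_simps)
  then interpret R: field R
  proof (rule cring.cring_fieldI2)
    fix a assume a: "a \<in> carrier R" "a \<noteq> \<zero>\<^bsub>R\<^esub>"
    then show "\<exists>b\<in>carrier R. a \<otimes>\<^bsub>R\<^esub> b = \<one>\<^bsub>R\<^esub>"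
      by (intro bexI[of _ "inverse a"]) (auto simp: R_def)
  qed (auto simp: R_def)
  have pow: "x [^]\<^bsub>R\<^esub> i = x ^ i" for x and i :: nat
    by (induction i) (simp_all add: R.nat_pow_0 R.nat_pow_Suc, simp_all add: R_def mult.commute)
  obtain a where "a \<in> carrier (mult_of R)"
    "carrier (mult_of R) = {a [^]\<^bsub>R\<^esub> i | i::nat. i \<in> UNIV}"
    using R.finite_field_mult_group_has_gen by (auto simp: R_def)
  moreover have "carrier (mult_of R) = UNIV - {0}"
    by (simp add: carrier_mult_of) (simp add: R_def)
  ultimately show ?thesis
    unfolding pow by (intro exI[of _ a]) auto
qed

locale finite_field_extension =
  fixes F :: "'a::{field,finite} set" and q n :: nat and g :: 'a
  assumes primepow_q: "primepow q"
    and n_pos: "n > 0"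
    and card_K: "CARD('a) = q ^ n"
    and subfield: "is_subfield F"
    and card_F: "card F = q"
    and g_nz: "g \<noteq> 0"
    and g_gen: "\<And>x. x \<noteq> 0 \<Longrightarrow> \<exists>i. x = g ^ i"
begin

definition L :: nat where "L = q ^ n - 1"

abbreviation Tr :: "'a \<Rightarrow> 'a" where "Tr \<equiv> field_trace q n"

lemma q_gt_1: "q > 1"
  using primepow_q using primepow_gt_Suc_0[of q] by simp

lemma q_power_n: "q ^ n = L + 1"
  using q_gt_1 by (simp add: L_def)

lemma L_pos: "L > 0"
  using q_gt_1 n_pos one_less_power[of q n] by (simp add: L_def)

lemma q_minus_1_dvd_L: "q - 1 dvd L"
proof -
  have "int q - 1 dvd int q ^ n - 1"
    using power_diff_1_eq[of "int q" n] by simp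
  then have "int (q - 1) dvd int L"
    using q_gt_1 by (simp add: of_nat_diff L_def)
  then show ?thesis
    by presburger
qed

lemma nonzero_power_L:
  fixes x :: 'a
  assumes "x \<noteq> 0"
  shows "x ^ L = 1"
proof -
  have "x ^ card (UNIV - {0::'a}) = 1"
    using assms by (intro power_card_eq_1_of_mult_closed) auto
  then show ?thesis
    by (simp add: card_K q_power_n)
qed

lemma power_mod_L:
  fixes x :: 'a
  assumes "x \<noteq> 0"
  shows "x ^ (i mod L) = x ^ i"
proof -
  have "x ^ i = x ^ (L * (i div L) + i mod L)"
    by simp
  also have "\<dots> = x ^ (i mod L)"
    unfolding power_add power_mult using nonzero_power_L[OF assms] by simp
  finally show ?thesis ..
qed

lemma bij_betw_g_power: "bij_betw (\<lambda>i. g ^ i) {..<L} (UNIV - {0})"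
proof -
  have surj: "(\<lambda>i. g ^ i) ` {..<L} = UNIV - {0}"
  proof (intro equalityI subsetI)
    fix x :: 'a assume "x \<in> UNIV - {0}"
    then obtain i where "x = g ^ i"
      using g_gen by blast
    then have "x = g ^ (i mod L)"
      using power_mod_L g_nz by simp
    then show "x \<in> (\<lambda>i. g ^ i) ` {..<L}"
      using L_pos by auto
  qed (use g_nz in auto)
  moreover have "inj_on (\<lambda>i. g ^ i) {..<L}"
    by (rule eq_card_imp_inj_on) (simp_all add: surj card_K q_power_n)
  ultimately show ?thesis
    by (simp add: bij_betw_def)
qed

text \<open>\<open>dlog 0\<close> has no meaningful value: \<open>chi\<close> treats 0 separately,
  and 0 never lies in a set \<open>Z P\<close>.\<close>

definition dlog :: "'a \<Rightarrow> nat" where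
  "dlog = inv_into {..<L} (\<lambda>i. g ^ i)"

lemma g_power_dlog: "x \<noteq> 0 \<Longrightarrow> g ^ dlog x = x"
  unfolding dlog_def using bij_betw_g_power
  by (metis DiffI UNIV_I bij_betw_imp_surj_on f_inv_into_f singletonD)

lemma dlog_g_power: "dlog (g ^ i) = i mod L"
proof -
  have "dlog (g ^ i) = dlog (g ^ (i mod L))"
    using power_mod_L g_nz by simp
  also have "\<dots> = i mod L"
    unfolding dlog_def using bij_betw_g_power L_pos
    by (intro inv_into_f_f) (auto simp: bij_betw_def)
  finally show ?thesis .
qed

lemma g_power_eq_1_iff: "g ^ i = 1 \<longleftrightarrow> L dvd i"
proof
  assume "g ^ i = 1"
  then have "i mod L = 0 mod L"
    using dlog_g_power[of i] dlog_g_power[of 0] by simp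
  then show "L dvd i"
    by (simp add: mod_eq_0_iff_dvd)
next
  assume "L dvd i"
  then show "g ^ i = 1"
    using nonzero_power_L[OF g_nz] by (auto simp: power_mult)
qed

lemma dlog_power:
  assumes "x \<noteq> 0"
  shows "dlog (x ^ k) = (k * dlog x) mod L"
  using dlog_g_power[of "dlog x * k"]
  by (simp only: power_mult g_power_dlog[OF assms] mult.commute[of k])

section \<open>The subfield and the trace\<close>

lemma zero_in_F: "0 \<in> F"
  and mult_in_F: "x \<in> F \<Longrightarrow> y \<in> F \<Longrightarrow> x * y \<in> F"
  and inverse_in_F: "x \<in> F \<Longrightarrow> inverse x \<in> F"
  using subfield by (auto simp: is_subfield_def)

text \<open>The characteristic is a prime dividing \<open>p ^ (e * n)\<close>, hence equals
  \<open>p\<close>, and powers of \<open>q\<close> are powers of it.\<close>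

lemma frobenius_add: "(x + y :: 'a) ^ (q ^ i) = x ^ (q ^ i) + y ^ (q ^ i)"
proof -
  obtain p e where pe: "prime p" "q = p ^ e"
    using primepow_q by (auto simp: primepow_def)
  have pos: "CHAR('a) > 0"
    by (rule finite_imp_CHAR_pos) simp
  then have prime: "prime CHAR('a)"
    by (rule prime_CHAR_semidom)
  have "CHAR('a) dvd p ^ (e * n)"
    using CHAR_dvd_CARD[where ?'a='a] by (simp add: card_K pe power_mult)
  then have "CHAR('a) = p"
    using pe(1) prime prime_dvd_power[OF prime] primes_dvd_imp_eq by blast
  then show ?thesis
    using freshmans_dream_CHAR_power[OF prime, of x y "e * i"] by (simp add: pe power_mult)
qed

lemma frobenius_fixes_F:
  assumes "x \<in> F"
  shows "x ^ q = x"
proof (cases "x = 0")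
  case False
  have "x ^ card (F - {0}) = 1"
    using False assms by (intro power_card_eq_1_of_mult_closed) (auto intro: mult_in_F)
  then have "x ^ (q - 1) = 1"
    using zero_in_F by (simp add: card_F)
  moreover have "x ^ q = x ^ (q - 1) * x"
    using q_gt_1 power_Suc2[of x "q - 1"] by simp
  ultimately show ?thesis
    by simp
qed (use q_gt_1 in auto)

lemma frobenius_power_fixes_F: "x \<in> F \<Longrightarrow> x ^ (q ^ i) = x"
  by (induction i) (simp_all add: power_mult frobenius_fixes_F)

text \<open>The polynomial \<open>X ^ q - X\<close> has at most \<open>q\<close> roots, and
  \<open>F\<close> already supplies that many.\<close>

lemma F_eq: "F = {x. x ^ q = x}"
proof (rule card_seteq)
  let ?P = "Polynomial.monom (1::'a) q - Polynomial.monom 1 1"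
  have deg: "Polynomial.degree ?P = q"
    using q_gt_1 degree_add_eq_left[of "- Polynomial.monom 1 1" "Polynomial.monom (1::'a) q"]
    by (simp add: degree_monom_eq)
  then have "?P \<noteq> 0"
    using q_gt_1 by auto
  then have "card {x. poly ?P x = 0} \<le> q"
    using card_poly_roots_bound[of ?P] deg by simp
  then show "card {x::'a. x ^ q = x} \<le> card F"
    by (simp add: poly_monom card_F)
qed (use frobenius_fixes_F in auto)

lemma Tr_0: "Tr 0 = 0"
  using q_gt_1 by (simp add: field_trace_def power_0_left)

lemma Tr_add: "Tr (x + y) = Tr x + Tr y"
  by (simp add: field_trace_def frobenius_add sum.distrib)

lemma Tr_diff: "Tr (x - y) = Tr x - Tr y"
  using Tr_add[of "x - y" y] by simp

lemma Tr_mult_F: "c \<in> F \<Longrightarrow> Tr (c * x) = c * Tr x"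
  by (simp add: field_trace_def power_mult_distrib frobenius_power_fixes_F sum_distrib_left)

text \<open>Raising to the power \<open>q\<close> shifts the summands cyclically, because
  \<open>x ^ (q ^ n) = x\<close>.\<close>

lemma Tr_in_F: "Tr x \<in> F"
proof -
  have sum_pow: "(\<Sum>i\<in>A. f i) ^ q = (\<Sum>i\<in>A. f i ^ q)" if "finite A" for A and f :: "nat \<Rightarrow> 'a"
    using that q_gt_1 frobenius_add[of _ _ 1]
    by (induction A rule: finite_induct) auto
  have "x ^ (q ^ n) = x"
  proof (cases "x = 0")
    case False
    then have "x ^ (L + 1) = x"
      using nonzero_power_L[of x] by simp
    then show ?thesis
      by (simp add: q_power_n)
  qed (use q_gt_1 in auto)
  then have "(\<Sum>i<n. x ^ (q ^ Suc i)) = (\<Sum>i<n. x ^ (q ^ i))"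
    using sum.lessThan_Suc_shift[of "\<lambda>i. x ^ (q ^ i)" n] by simp
  moreover have "Tr x ^ q = (\<Sum>i<n. x ^ (q ^ Suc i))"
    by (simp add: field_trace_def sum_pow power_mult[symmetric] mult.commute)
  ultimately have "Tr x ^ q = Tr x"
    by (simp add: field_trace_def)
  then show ?thesis
    by (simp add: F_eq)
qed

text \<open>The trace is a polynomial of degree \<open>q ^ (n - 1)\<close>, so no fibre is larger
  than that; the \<open>q\<close> fibres over \<open>F\<close> cover \<open>q ^ n\<close> elements,
  so none is smaller.\<close>

lemma card_Tr_fibre:
  assumes "c \<in> F"
  shows "card {y. Tr y = c} = q ^ (n - 1)"
proof -
  have le: "card {y. Tr y = b} \<le> q ^ (n - 1)" for b
  proof -
    let ?P = "\<lambda>m. (\<Sum>i<m. Polynomial.monom (1::'a) (q ^ i))"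
    have small: "Polynomial.degree (?P m) < q ^ m" for m
    proof (induction m)
      case (Suc m)
      have "q ^ m < q ^ Suc m"
        using q_gt_1 by simp
      moreover have "Polynomial.degree (Polynomial.monom (1::'a) (q ^ m)) = q ^ m"
        by (simp add: degree_monom_eq)
      ultimately show ?case
        using Suc degree_add_le_max[of "?P m" "Polynomial.monom 1 (q ^ m)"]
        unfolding sum.lessThan_Suc by linarith
    qed simp
    obtain m where m: "n = Suc m"
      using n_pos by (cases n) auto
    have "Polynomial.degree (?P m - [:b:]) < q ^ m"
      using small[of m] degree_diff_le_max[of "?P m" "[:b:]"] q_gt_1 by simp
    then have deg: "Polynomial.degree (Polynomial.monom 1 (q ^ m) + (?P m - [:b:])) = q ^ m"
      by (subst degree_add_eq_left) (simp_all add: degree_monom_eq)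
    have "q ^ m > 0"
      using q_gt_1 by simp
    then have "Polynomial.monom 1 (q ^ m) + (?P m - [:b:]) \<noteq> 0"
      using deg by (metis degree_0 less_irrefl)
    then have "card {x. poly (Polynomial.monom 1 (q ^ m) + (?P m - [:b:])) x = 0} \<le> q ^ m"
      using card_poly_roots_bound deg by metis
    moreover have "poly (Polynomial.monom 1 (q ^ m) + (?P m - [:b:])) x = Tr x - b" for x
      by (simp add: m field_trace_def poly_sum poly_monom)
    ultimately show ?thesis
      by (simp only: m diff_Suc_1) simp
  qed
  have fin: "finite F" by simp
  have "(\<Sum>b\<in>F. card {y. Tr y = b}) = card (\<Union>b\<in>F. {y. Tr y = b})"
    by (subst card_UN_disjoint) auto
  also have "(\<Union>b\<in>F. {y. Tr y = b}) = UNIV"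
    using Tr_in_F by auto
  also have "card \<dots> = (\<Sum>b\<in>F. q ^ (n - 1))"
    using n_pos by (cases n) (simp_all add: card_K card_F)
  \<comment> \<open>By \<open>le\<close> no natural subtraction is truncated, so a zero total forces
    every deficit to vanish.\<close>
  finally have "(\<Sum>b\<in>F. q ^ (n - 1) - card {y. Tr y = b}) = 0"
    using le by (subst sum_subtractf_nat) auto
  then show ?thesis
    using assms fin le[of c] by (auto simp: sum_eq_0_iff intro: antisym)
qed

section \<open>Multiplicative characters on the fibres of the trace\<close>

definition \<omega> :: complex where "\<omega> = cis (2 * pi / real L)"

lemma norm_\<omega>: "norm \<omega> = 1"
  by (simp add: \<omega>_def)

lemma \<omega>_power_eq_1_iff: "\<omega> ^ k = 1 \<longleftrightarrow> L dvd k"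
proof
  assume "\<omega> ^ k = 1"
  then have "cis (real k * (2 * pi / real L)) = 1"
    by (simp only: \<omega>_def DeMoivre)
  then have "cos (real k * (2 * pi / real L)) = 1"
    by (simp add: complex_eq_iff)
  then obtain i :: int where "real k * (2 * pi / real L) = of_int i * (2 * pi)"
    using cos_one_2pi_int by (metis mult.assoc)
  then have "real k = of_int i * real L"
    using L_pos by (simp add: field_simps)
  then have "real_of_int (int k) = real_of_int (i * int L)"
    by simp
  then have "int k = i * int L"
    by linarith
  then show "L dvd k"
    by (metis dvd_triv_right of_nat_dvd_iff)
next
  assume "L dvd k"
  then obtain m where "k = L * m" by blast
  then show "\<omega> ^ k = 1"
    using L_pos by (simp add: \<omega>_def DeMoivre power_mult)
qed

lemma \<omega>_power_mod: "\<omega> ^ (k mod L) = \<omega> ^ k"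
proof -
  have "\<omega> ^ k = \<omega> ^ (L * (k div L) + k mod L)"
    by simp
  also have "\<dots> = \<omega> ^ (k mod L)"
    unfolding power_add using \<omega>_power_eq_1_iff[of "L * (k div L)"] by simp
  finally show ?thesis ..
qed

text \<open>The index \<open>j\<close> matters only modulo \<open>L\<close>; the character is
  trivial exactly when \<open>L\<close> divides \<open>j\<close>. Even \<open>chi 0\<close> vanishes
  at 0.\<close>

definition chi :: "nat \<Rightarrow> 'a \<Rightarrow> complex" where
  "chi j x = (if x = 0 then 0 else \<omega> ^ (j * dlog x))"

lemma chi_0 [simp]: "chi j 0 = 0"
  by (simp add: chi_def)

lemma chi_g_power: "chi j (g ^ i) = \<omega> ^ (j * i)"
  using \<omega>_power_mod[of "j * (i mod L)"] \<omega>_power_mod[of "j * i"] g_nz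
  by (simp add: chi_def dlog_g_power mod_mult_right_eq)

lemma chi_1 [simp]: "chi j 1 = 1"
  using chi_g_power[of j 0] by simp

lemma chi_mult: "chi j (x * y) = chi j x * chi j y"
proof (cases "x = 0 \<or> y = 0")
  case False
  then have "x * y = g ^ (dlog x + dlog y)"
    by (simp add: power_add g_power_dlog)
  then have "chi j (x * y) = \<omega> ^ (j * (dlog x + dlog y))"
    by (simp add: chi_g_power)
  then show ?thesis
    using False by (simp add: chi_def distrib_left power_add)
qed auto

lemma chi_add: "chi (i + j) x = chi i x * chi j x"
  by (simp add: chi_def distrib_right power_add)

lemma norm_chi: "x \<noteq> 0 \<Longrightarrow> norm (chi j x) = 1"
  by (simp add: chi_def norm_power norm_\<omega>)

lemma chi_mult_cnj: "x \<noteq> 0 \<Longrightarrow> chi j x * cnj (chi j x) = 1"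
  using norm_chi[of x j] by (simp add: complex_norm_square[symmetric])

text \<open>From \<open>c ^ (q - 1) = 1\<close> it follows that \<open>L\<close> divides
  \<open>dlog c * (q - 1)\<close>, hence also \<open>j * dlog c\<close>.\<close>

lemma chi_eq_1_on_F:
  assumes "q - 1 dvd j" "c \<in> F" "c \<noteq> 0"
  shows "chi j c = 1"
proof -
  have "c ^ (q - 1) * c = c"
    using frobenius_fixes_F[OF assms(2)] q_gt_1 power_Suc2[of c "q - 1"] by simp
  then have "c ^ (q - 1) = 1"
    using assms by simp
  then have "g ^ (dlog c * (q - 1)) = 1"
    using assms by (simp add: power_mult g_power_dlog)
  then have "L dvd dlog c * (q - 1)"
    by (simp add: g_power_eq_1_iff)
  also have "\<dots> dvd j * dlog c"
    using assms(1) by (subst mult.commute) (intro mult_dvd_mono, auto)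
  finally show ?thesis
    using assms by (simp add: chi_def \<omega>_power_eq_1_iff)
qed

lemma sum_chi_eq_0:
  assumes "\<not> L dvd j"
  shows "(\<Sum>x\<in>UNIV. chi j x) = 0"
proof -
  have "bij ((*) g)"
    using g_nz by (intro bijI) (auto simp: inj_def surj_def intro: exI[of _ "_ / g"])
  then have "(\<Sum>x\<in>UNIV. chi j x) = (\<Sum>x\<in>UNIV. chi j (g * x))"
    by (rule sum.reindex_bij_betw[symmetric])
  also have "\<dots> = chi j g * (\<Sum>x\<in>UNIV. chi j x)"
    by (simp add: chi_mult sum_distrib_left)
  finally have "(1 - chi j g) * (\<Sum>x\<in>UNIV. chi j x) = 0"
    by (simp add: algebra_simps)
  moreover have "chi j g \<noteq> 1"
    using assms chi_g_power[of j 1] \<omega>_power_eq_1_iff[of j] by simp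
  ultimately show ?thesis
    by simp
qed

section \<open>Character sums over the fibres of the trace and their second moment\<close>

definition T :: "nat \<Rightarrow> 'a \<Rightarrow> complex" where
  "T j c = (\<Sum>y | Tr y = c. chi j y)"

lemma card_Tr_mult_eq_0:
  "card {z. z \<noteq> 0 \<and> Tr (w * z) = 0} = (if w = 0 then L else q ^ (n - 1) - 1)"
proof (cases "w = 0")
  case True
  have "{z::'a. z \<noteq> 0} = UNIV - {0}" by auto
  then show ?thesis
    using True by (simp add: Tr_0 card_K q_power_n)
next
  case False
  have "bij_betw (\<lambda>z. w * z) {z. z \<noteq> 0 \<and> Tr (w * z) = 0} ({z. Tr z = 0} - {0})"
    by (rule bij_betwI[where g = "\<lambda>z. z / w"]) (use False in auto)
  then have "card {z. z \<noteq> 0 \<and> Tr (w * z) = 0} = card ({z. Tr z = 0} - {0})"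
    by (rule bij_betw_same_card)
  also have "\<dots> = q ^ (n - 1) - 1"
    using card_Tr_fibre[OF zero_in_F] Tr_0 by (subst card_Diff_subset) auto
  finally show ?thesis
    using False by simp
qed

text \<open>Expanding \<open>|T j c|\<^sup>2\<close> and substituting \<open>y = u z\<close> reduces the sum over \<open>z\<close> to counting the
  zeros of \<open>z \<mapsto> Tr ((u - 1) z)\<close>, so no additive characters are needed.\<close>

lemma sum_norm_T:
  assumes "\<not> L dvd j"
  shows "(\<Sum>c\<in>F. (norm (T j c))\<^sup>2) = real q ^ (n - 1) * (real q - 1)"
proof -
  have "(\<Sum>c\<in>F. complex_of_real ((norm (T j c))\<^sup>2)) = (\<Sum>c\<in>F. T j c * cnj (T j c))"
    by (simp only: complex_norm_square)
  also have "\<dots> = (\<Sum>c\<in>F. \<Sum>z\<in>{z\<in>UNIV. Tr z = c}. \<Sum>y | Tr y = Tr z. chi j y * cnj (chi j z))"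
  proof (rule sum.cong[OF refl])
    fix c
    have "T j c * cnj (T j c) = (\<Sum>z | Tr z = c. \<Sum>y | Tr y = c. chi j y * cnj (chi j z))"
      unfolding T_def cnj_sum sum_product by (rule sum.swap)
    then show "T j c * cnj (T j c)
        = (\<Sum>z\<in>{z\<in>UNIV. Tr z = c}. \<Sum>y | Tr y = Tr z. chi j y * cnj (chi j z))"
      by simp
  qed
  also have "\<dots> = (\<Sum>z\<in>UNIV. \<Sum>y | Tr y = Tr z. chi j y * cnj (chi j z))"
    by (rule sum.group) (auto simp: Tr_in_F)
  also have "\<dots> = (\<Sum>z\<in>UNIV - {0}. \<Sum>y | Tr y = Tr z. chi j y * cnj (chi j z))"
    by (rule sum.mono_neutral_right) auto
  also have "\<dots> = (\<Sum>z\<in>UNIV - {0}. \<Sum>u\<in>{u\<in>UNIV. Tr ((u - 1) * z) = 0}. chi j u)"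
  proof (rule sum.cong[OF refl])
    fix z :: 'a assume "z \<in> UNIV - {0}"
    then have z: "z \<noteq> 0" by simp
    have "bij_betw (\<lambda>u. u * z) {u\<in>UNIV. Tr ((u - 1) * z) = 0} {y. Tr y = Tr z}"
      by (rule bij_betwI[where g = "\<lambda>y. y / z"])
        (use z in \<open>auto simp: left_diff_distrib Tr_diff\<close>)
    then have "(\<Sum>y | Tr y = Tr z. chi j y * cnj (chi j z))
        = (\<Sum>u\<in>{u\<in>UNIV. Tr ((u - 1) * z) = 0}. chi j (u * z) * cnj (chi j z))"
      by (rule sum.reindex_bij_betw[symmetric])
    also have "\<dots> = (\<Sum>u\<in>{u\<in>UNIV. Tr ((u - 1) * z) = 0}. chi j u)"
      using chi_mult_cnj[OF z] by (simp add: chi_mult mult.assoc)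
    finally show "(\<Sum>y | Tr y = Tr z. chi j y * cnj (chi j z))
        = (\<Sum>u\<in>{u\<in>UNIV. Tr ((u - 1) * z) = 0}. chi j u)" .
  qed
  also have "\<dots> = (\<Sum>u\<in>UNIV. \<Sum>z\<in>{z\<in>UNIV - {0}. Tr ((u - 1) * z) = 0}. chi j u)"
    by (rule sum.swap_restrict) auto
  also have "\<dots> = (\<Sum>u\<in>UNIV. of_nat (card {z. z \<noteq> 0 \<and> Tr ((u - 1) * z) = 0}) * chi j u)"
    by (simp add: conj_commute)
  \<comment> \<open>Only \<open>u = 1\<close> admits all \<open>L\<close> nonzero \<open>z\<close>.
    Its excess is split off, and orthogonality kills the remaining constant multiple of the full
    character sum.\<close>
  also have "\<dots> = (\<Sum>u\<in>UNIV. of_nat (q ^ (n - 1) - 1) * chi j u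
      + (if u = 1 then of_nat L - of_nat (q ^ (n - 1) - 1) else 0))"
    by (rule sum.cong) (auto simp: card_Tr_mult_eq_0)
  also have "\<dots> = of_nat L - of_nat (q ^ (n - 1) - 1)"
    using sum_chi_eq_0[OF assms] by (simp add: sum.distrib sum_distrib_left[symmetric])
  also have "\<dots> = of_real (real q ^ (n - 1) * (real q - 1))"
  proof -
    obtain m where "n = Suc m"
      using n_pos by (cases n) auto
    moreover have "of_nat L = (of_nat q ^ n - 1 :: complex)"
      using q_gt_1 by (simp add: L_def of_nat_diff)
    ultimately show ?thesis
      using q_gt_1 by (simp add: of_nat_diff algebra_simps)
  qed
  finally show ?thesis
    using of_real_eq_iff by (metis of_real_sum)
qed

lemma T_mult_F:
  assumes "c \<in> F" "c \<noteq> 0"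
  shows "T j (c * b) = chi j c * T j b"
proof -
  have "bij_betw (\<lambda>y. c * y) {y. Tr y = b} {y. Tr y = c * b}"
    by (rule bij_betwI[where g = "\<lambda>y. inverse c * y"])
      (use assms inverse_in_F in \<open>auto simp: Tr_mult_F\<close>)
  then have "(\<Sum>y | Tr y = c * b. chi j y) = (\<Sum>y | Tr y = b. chi j (c * y))"
    by (rule sum.reindex_bij_betw[symmetric])
  then show ?thesis
    by (simp add: T_def chi_mult sum_distrib_left)
qed

lemma T_eq_chi_mult:
  assumes "c \<in> F" "c \<noteq> 0" "b \<in> F" "b \<noteq> 0"
  shows "T j c = chi j (c * inverse b) * T j b"
  using T_mult_F[of "c * inverse b" j b] assms mult_in_F inverse_in_F by (simp add: mult.assoc)

text \<open>Scaling by nonzero elements of \<open>F\<close> preserves the norm, so the second moment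
  contains \<open>q - 1\<close> equal terms; the term at 0 is dropped.\<close>

lemma norm_T_le:
  assumes "\<not> L dvd j" "b \<in> F" "b \<noteq> 0"
  shows "(norm (T j b))\<^sup>2 \<le> real q ^ (n - 1)"
proof -
  have "(real q - 1) * (norm (T j b))\<^sup>2 = (\<Sum>c\<in>F - {0}. (norm (T j b))\<^sup>2)"
    using q_gt_1 zero_in_F by (simp add: card_F of_nat_diff)
  also have "\<dots> = (\<Sum>c\<in>F - {0}. (norm (T j c))\<^sup>2)"
  proof (rule sum.cong[OF refl])
    fix c assume "c \<in> F - {0}"
    then show "(norm (T j b))\<^sup>2 = (norm (T j c))\<^sup>2"
      using assms by (subst T_eq_chi_mult[of c b]) (auto simp: norm_mult norm_chi)
  qed
  also have "\<dots> \<le> (\<Sum>c\<in>F. (norm (T j c))\<^sup>2)"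
    by (rule sum_mono2) auto
  also have "\<dots> = (real q - 1) * real q ^ (n - 1)"
    using sum_norm_T[OF assms(1)] by simp
  finally show ?thesis
    using q_gt_1 by simp
qed

text \<open>Here \<open>T j\<close> is constant on \<open>F - {0}\<close> and sums to 0 over
  \<open>F\<close>, so \<open>T j 0 = - (q - 1) * T j b\<close>. The second moment becomes
  \<open>((q - 1)^2 + (q - 1))\<close> times the squared norm, which determines it exactly.\<close>

lemma norm_T_trivial_on_F:
  assumes "\<not> L dvd j" "q - 1 dvd j" "b \<in> F" "b \<noteq> 0"
  shows "real q * (norm (T j b))\<^sup>2 = real q ^ (n - 1)"
proof -
  have eq: "T j c = T j b" if "c \<in> F - {0}" for c
    using T_eq_chi_mult[of c b] that assms chi_eq_1_on_F[of j "c * inverse b"]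
    by (simp add: mult_in_F inverse_in_F)
  have "(\<Sum>c\<in>F. T j c) = (\<Sum>c\<in>F. \<Sum>y\<in>{y\<in>UNIV. Tr y = c}. chi j y)"
    by (simp add: T_def)
  also have "\<dots> = (\<Sum>y\<in>UNIV. chi j y)"
    by (rule sum.group) (auto simp: Tr_in_F)
  finally have "(\<Sum>c\<in>F. T j c) = 0"
    by (simp add: sum_chi_eq_0[OF assms(1)])
  moreover have "(\<Sum>c\<in>F. T j c) = T j 0 + (\<Sum>c\<in>F - {0}. T j b)"
    using eq zero_in_F by (subst sum.remove[of _ 0]) auto
  ultimately have "T j 0 = - of_real (real q - 1) * T j b"
    using q_gt_1 zero_in_F by (simp add: card_F of_nat_diff add_eq_0_iff algebra_simps)
  then have T0: "norm (T j 0) = (real q - 1) * norm (T j b)"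
    using q_gt_1 by (simp only: norm_mult norm_minus_cancel norm_of_real)
  have "real q ^ (n - 1) * (real q - 1) = (norm (T j 0))\<^sup>2 + (\<Sum>c\<in>F - {0}. (norm (T j c))\<^sup>2)"
    unfolding sum_norm_T[OF assms(1), symmetric] using zero_in_F by (subst sum.remove[of _ 0]) auto
  also have "(\<Sum>c\<in>F - {0}. (norm (T j c))\<^sup>2) = (\<Sum>c\<in>F - {0}. (norm (T j b))\<^sup>2)"
    using eq by simp
  also have "\<dots> = (real q - 1) * (norm (T j b))\<^sup>2"
    using q_gt_1 zero_in_F by (simp add: card_F of_nat_diff)
  finally have "(real q - 1) * real q ^ (n - 1) = (real q - 1) * (real q * (norm (T j b))\<^sup>2)"
    unfolding T0 by (simp add: power2_eq_square algebra_simps)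
  then show ?thesis
    using q_gt_1 by simp
qed

end

section \<open>The trace of a square\<close>

text \<open>There are \<open>p - 1\<close> summands divided by \<open>p\<close>, so the error
  acquires the same factor \<open>1 - 1 / p\<close> as the main term when a prime is
  inserted.\<close>

lemma norm_avg_le:
  fixes f :: "nat \<Rightarrow> complex"
  assumes "p > 0" "\<And>a. a \<in> {1..<p} \<Longrightarrow> norm (f a) \<le> B"
  shows "norm ((1 / of_nat p) * (\<Sum>a\<in>{1..<p}. f a)) \<le> (1 - 1 / real p) * B"
proof -
  have "norm (\<Sum>a\<in>{1..<p}. f a) \<le> of_nat (card {1..<p}) * B"
    using assms(2) by (rule sum_norm_bound)
  then have "norm (\<Sum>a\<in>{1..<p}. f a) / real p \<le> (real p - 1) * B / real p"
    using assms(1) by (intro divide_right_mono) (simp_all add: of_nat_diff)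
  moreover have "(real p - 1) * B / real p = (1 - 1 / real p) * B"
    using assms(1) by (simp add: field_simps)
  ultimately show ?thesis
    by (simp add: norm_mult norm_divide)
qed

locale square_trace = finite_field_extension F q n g
  for F :: "'a::{field,finite} set" and q n g +
  fixes \<beta> :: 'a and h :: nat
  assumes q_cong: "[q = 1] (mod 4)"
    and n_eq: "n = 2 * h + 1"
    and \<beta>_in_F: "\<beta> \<in> F"
    and \<beta>_nz: "\<beta> \<noteq> 0"
begin

text \<open>As \<open>n - 1 = 2 * h\<close>, this is the square root of the fibre size
  \<open>q ^ (n - 1)\<close>: errors have order \<open>X\<close>, the main term order
  \<open>X^2\<close>.\<close>

definition X :: real where "X = real q ^ h"

definition Q :: nat where "Q = L div (q - 1)"

lemma X_pos: "X > 0"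
  using q_gt_1 by (simp add: X_def)

lemma X_squared: "X\<^sup>2 = real q ^ (n - 1)"
  by (simp add: X_def n_eq power_mult[symmetric] mult.commute)

lemma L_eq: "L = Q * (q - 1)"
  using q_minus_1_dvd_L by (simp add: Q_def)

lemma four_dvd_L: "4 dvd L"
proof -
  have "[q ^ n = 1 ^ n] (mod 4)"
    using q_cong by (rule cong_pow)
  then have "[q ^ n = 1] (mod 4)"
    by simp
  then show ?thesis
    using cong_to_1_nat[of "q ^ n" 4] by (simp add: L_def)
qed

lemma odd_q: "odd q"
proof -
  have "q mod 4 = 1"
    using q_cong by (simp add: cong_def)
  then show ?thesis
    by presburger
qed

text \<open>\<open>Q\<close> is a sum of \<open>n\<close> odd powers of \<open>q\<close>, and
  \<open>n\<close> is odd.\<close>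

lemma odd_Q: "odd Q"
proof -
  have "int q ^ n - 1 = (int q - 1) * (\<Sum>i<n. int q ^ i)"
    by (rule power_diff_1_eq)
  moreover have "int L = int q ^ n - 1"
    using q_gt_1 by (simp add: L_def of_nat_diff)
  moreover have "int L = (int q - 1) * int Q"
    using q_gt_1 by (simp add: L_eq of_nat_diff)
  ultimately have "int Q = (\<Sum>i<n. int q ^ i)"
    using q_gt_1 by simp
  moreover have "odd (\<Sum>i<n. int q ^ i)"
    using odd_q n_eq by (simp add: even_sum_iff)
  ultimately show ?thesis
    using even_of_nat_iff[of Q, where ?'a=int] by simp
qed

lemma even_L [simp]: "even L"
  using four_dvd_L dvd_trans[of 2 4 L] by simp

lemma not_L_dvd_half_L: "\<not> L dvd L div 2"
proof -
  have "2 * (L div 2) = L"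
    by simp
  then have "L div 2 > 0"
    using L_pos by linarith
  then show ?thesis
    using dvd_imp_le[of L "L div 2"] by auto
qed

lemma \<omega>_half: "\<omega> ^ (L div 2) = -1"
proof -
  have "(\<omega> ^ (L div 2))\<^sup>2 = 1"
    using \<omega>_power_eq_1_iff[of "L div 2 * 2"] by (simp flip: power_mult)
  then have "\<omega> ^ (L div 2) = 1 \<or> \<omega> ^ (L div 2) = -1"
    by (simp add: power2_eq_1_iff)
  then show ?thesis
    using not_L_dvd_half_L \<omega>_power_eq_1_iff by blast
qed

lemma minus_1_neq_1: "(-1 :: 'a) \<noteq> 1"
proof -
  have "(g ^ (L div 2))\<^sup>2 = 1"
    using g_power_eq_1_iff[of "L div 2 * 2"] by (simp flip: power_mult)
  then have "g ^ (L div 2) = 1 \<or> g ^ (L div 2) = -1"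
    by (simp add: power2_eq_1_iff)
  moreover have "g ^ (L div 2) \<noteq> 1"
    using not_L_dvd_half_L g_power_eq_1_iff by blast
  ultimately show ?thesis
    by auto
qed

text \<open>\<open>chi (L div 2)\<close> is the quadratic character: a nonzero element is a square
  exactly when its discrete logarithm is even, as \<open>L\<close> is even.\<close>

lemma card_square_roots:
  assumes "y \<noteq> 0"
  shows "complex_of_nat (card {x. x\<^sup>2 = y}) = 1 + chi (L div 2) y"
proof (cases "even (dlog y)")
  case True
  then obtain t where t: "dlog y = 2 * t" by blast
  define z where "z = g ^ t"
  have z: "z\<^sup>2 = y" "z \<noteq> 0"
    using g_power_dlog[OF assms] g_nz by (simp_all add: z_def t power_mult mult.commute)
  have "z \<noteq> - z"
  proof
    assume "z = - z"
    then have "(-1) * z = 1 * z" by simp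
    then show False
      using z minus_1_neq_1 by (metis mult_right_cancel)
  qed
  moreover have "{x. x\<^sup>2 = y} = {z, - z}"
    unfolding z(1)[symmetric] by (auto simp: power2_eq_iff)
  moreover have "chi (L div 2) y = 1"
    using assms \<omega>_power_eq_1_iff[of "L div 2 * (2 * t)"]
    by (simp add: chi_def t mult.assoc[symmetric])
  ultimately show ?thesis
    by simp
next
  case False
  have "{x. x\<^sup>2 = y} = {}"
  proof (rule ccontr)
    assume "{x. x\<^sup>2 = y} \<noteq> {}"
    then obtain x where "y = x\<^sup>2" by auto
    then have "dlog y = (2 * dlog x) mod L"
      using assms dlog_power[of x 2] by auto
    then have "even (dlog y)"
      by (simp add: dvd_mod_iff)
    with False show False by simp
  qed
  moreover have "chi (L div 2) y = -1"
    using assms False by (simp add: chi_def power_mult \<omega>_half)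
  ultimately show ?thesis
    by simp
qed

definition S :: "nat \<Rightarrow> complex" where
  "S j = (\<Sum>x | Tr (x\<^sup>2) = \<beta>. chi j x)"

lemma S_double: "S (2 * i) = T i \<beta> + T (i + L div 2) \<beta>"
proof -
  have "S (2 * i) = (\<Sum>x | Tr (x\<^sup>2) = \<beta>. chi i (x\<^sup>2))"
    unfolding S_def by (simp add: mult_2 chi_add chi_mult power2_eq_square)
  also have "\<dots> = (\<Sum>y | Tr y = \<beta>. \<Sum>x\<in>{x\<in>{x. Tr (x\<^sup>2) = \<beta>}. x\<^sup>2 = y}. chi i (x\<^sup>2))"
    by (rule sum.group[symmetric]) auto
  also have "\<dots> = (\<Sum>y | Tr y = \<beta>. chi i y + chi (i + L div 2) y)"
  proof (rule sum.cong[OF refl])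
    fix y assume y: "y \<in> {y. Tr y = \<beta>}"
    then have "y \<noteq> 0"
      using \<beta>_nz Tr_0 by auto
    have "(\<Sum>x\<in>{x\<in>{x. Tr (x\<^sup>2) = \<beta>}. x\<^sup>2 = y}. chi i (x\<^sup>2)) = (\<Sum>x | x\<^sup>2 = y. chi i y)"
      using y by (intro sum.cong) auto
    also have "\<dots> = chi i y + chi (i + L div 2) y"
      using card_square_roots[OF \<open>y \<noteq> 0\<close>] by (simp add: chi_add algebra_simps)
    finally show "(\<Sum>x\<in>{x\<in>{x. Tr (x\<^sup>2) = \<beta>}. x\<^sup>2 = y}. chi i (x\<^sup>2))
        = chi i y + chi (i + L div 2) y" .
  qed
  finally show ?thesis
    by (simp add: T_def sum.distrib)
qed

lemma norm_T_le_X: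
  assumes "\<not> L dvd i"
  shows "norm (T i \<beta>) \<le> X"
proof (rule power2_le_imp_le)
  show "(norm (T i \<beta>))\<^sup>2 \<le> X\<^sup>2"
    unfolding X_squared using assms \<beta>_in_F \<beta>_nz by (rule norm_T_le)
qed (use X_pos in simp)

lemma norm_T_trivial_on_F_eq:
  assumes "\<not> L dvd i" "q - 1 dvd i"
  shows "norm (T i \<beta>) = X / sqrt q"
proof -
  have "(sqrt q * norm (T i \<beta>))\<^sup>2 = X\<^sup>2"
    using norm_T_trivial_on_F[OF assms \<beta>_in_F \<beta>_nz] by (simp add: X_squared power_mult_distrib)
  then have "sqrt q * norm (T i \<beta>) = X"
    using X_pos by (simp add: power2_eq_iff_nonneg)
  then show ?thesis
    using q_gt_1 by (simp add: field_simps)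
qed

lemma not_L_dvd_shift:
  assumes "\<not> L dvd 2 * i"
  shows "\<not> L dvd i + L div 2"
proof
  assume "L dvd i + L div 2"
  then have "L dvd 2 * (i + L div 2)"
    by (rule dvd_mult)
  then have "L dvd 2 * i + L"
    by (simp add: distrib_left)
  then show False
    using assms by simp
qed

lemma S_nontrivial:
  assumes "even j" "\<not> L dvd j"
  shows "norm (S j) \<le> 2 * X"
proof -
  obtain i where i: "j = 2 * i" using assms(1) by blast
  have 1: "\<not> L dvd i"
    using assms(2) i by auto
  have 2: "\<not> L dvd i + L div 2"
    using assms(2) unfolding i by (rule not_L_dvd_shift)
  show ?thesis
    using norm_T_le_X[OF 1] norm_T_le_X[OF 2]
      norm_triangle_ineq[of "T i \<beta>" "T (i + L div 2) \<beta>"] by (simp add: i S_double)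
qed

lemma S_trivial_on_F:
  assumes "even j" "\<not> L dvd j" "q - 1 dvd j"
  shows "norm (S j) \<le> (1 + 1 / sqrt q) * X"
proof -
  obtain i where i: "j = 2 * i" using assms(1) by blast
  have 1: "\<not> L dvd i"
    using assms(2) i by auto
  have 2: "\<not> L dvd i + L div 2"
    using assms(2) unfolding i by (rule not_L_dvd_shift)
  \<comment> \<open>With \<open>q - 1 = 2 * u\<close> and \<open>j = (q - 1) * v\<close> we have
    \<open>i = u * v\<close> and \<open>L div 2 = Q * u\<close>. If \<open>v\<close> is odd, adding
    the odd \<open>Q\<close> makes the cofactor of \<open>u\<close> even.\<close>
  have "q - 1 dvd i \<or> q - 1 dvd i + L div 2"
  proof -
    obtain u where u: "q - 1 = 2 * u"
      using odd_q by (elim oddE) auto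
    obtain v where v: "j = (q - 1) * v"
      using assms(3) by blast
    have iv: "i = u * v"
      using i u v by simp
    have Lh: "L div 2 = Q * u"
      using L_eq u by simp
    show ?thesis
    proof (cases "even v")
      case True
      then show ?thesis
        using iv u by auto
    next
      case False
      then have "even (v + Q)"
        using odd_Q by simp
      then obtain w where "v + Q = 2 * w" by blast
      moreover have "i + L div 2 = u * (v + Q)"
        by (simp add: iv Lh distrib_left mult.commute)
      ultimately have "i + L div 2 = (q - 1) * w"
        by (simp only: u mult_ac)
      then show ?thesis
        by simp
    qed
  qed
  then have "norm (T i \<beta>) + norm (T (i + L div 2) \<beta>) \<le> X + X / sqrt q"
    using norm_T_le_X[OF 1] norm_T_le_X[OF 2] norm_T_trivial_on_F_eq[OF 1]
      norm_T_trivial_on_F_eq[OF 2] by linarith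
  then show ?thesis
    using norm_triangle_ineq[of "T i \<beta>" "T (i + L div 2) \<beta>"]
    by (simp add: i S_double distrib_right)
qed

text \<open>\<open>T 0\<close> counts a trace fibre and gives the main term exactly; the error is
  the single quadratic sum \<open>T (L div 2)\<close>.\<close>

lemma S_principal: "norm (S 0 - of_real (X\<^sup>2)) \<le> X"
proof -
  have "T 0 \<beta> = (\<Sum>y | Tr y = \<beta>. 1)"
    unfolding T_def using Tr_0 \<beta>_nz by (intro sum.cong) (auto simp: chi_def)
  then have "T 0 \<beta> = of_nat (q ^ (n - 1))"
    using card_Tr_fibre[OF \<beta>_in_F] by simp
  then have "T 0 \<beta> = of_real (X\<^sup>2)"
    by (simp only: X_squared of_nat_power of_real_power of_real_of_nat_eq)
  then show ?thesis
    using S_double[of 0] norm_T_le_X[OF not_L_dvd_half_L] by simp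
qed

section \<open>The sieve\<close>

text \<open>For a prime \<open>p\<close> dividing \<open>L\<close>, the condition on
  \<open>dlog x\<close> says that \<open>x\<close> is not a \<open>p\<close>-th power. The value 0
  is excluded because its trace is 0.\<close>

definition Z :: "nat set \<Rightarrow> 'a set" where
  "Z P = {x. Tr (x\<^sup>2) = \<beta> \<and> (\<forall>p\<in>P. \<not> p dvd dlog x)}"

text \<open>\<open>A P 0\<close> is the wanted count; the twisted sums are carried along because
  inserting a prime produces them.\<close>

definition A :: "nat set \<Rightarrow> nat \<Rightarrow> complex" where
  "A P j = (\<Sum>x\<in>Z P. chi j x)"

text \<open>The proportion of exponents modulo \<open>L\<close> that avoid all the primes in
  \<open>P\<close>, hence the expected density of \<open>Z P\<close>.\<close>

definition \<theta> :: "nat set \<Rightarrow> real" where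
  "\<theta> P = (\<Prod>p\<in>P. 1 - 1 / real p)"

definition over_Q :: "nat set \<Rightarrow> nat set" where
  "over_Q P = {p\<in>P. p dvd Q}"

text \<open>In units of \<open>X\<close>, a nontrivial character sum over \<open>Tr (x\<^sup>2) = \<beta>\<close> is at most \<open>2\<close>, and at most
  \<open>2 - c\<close> if the character is trivial on \<open>F\<close>, that is, if its order divides \<open>Q\<close>.\<close>

definition c :: real where "c = 1 - 1 / sqrt q"

text \<open>Each subset of \<open>P\<close> stands for a squarefree character order and costs 2,
  reduced by \<open>c\<close> when all its primes divide \<open>Q\<close>.\<close>

definition E :: "nat set \<Rightarrow> real" where
  "E P = 2 * 2 ^ card P - c * 2 ^ card (over_Q P)"

abbreviation L_primes :: "nat set \<Rightarrow> bool" where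
  "L_primes P \<equiv> finite P \<and> (\<forall>p\<in>P. prime p \<and> p dvd L)"

lemma Z_nonzero: "x \<in> Z P \<Longrightarrow> x \<noteq> 0"
  using Tr_0 \<beta>_nz by (auto simp: Z_def)

lemma A_empty: "A {} j = S j"
  by (simp add: A_def S_def Z_def)

lemma A_0: "A P 0 = of_nat (card (Z P))"
proof -
  have "A P 0 = (\<Sum>x\<in>Z P. 1)"
    unfolding A_def using Z_nonzero by (intro sum.cong) (auto simp: chi_def)
  then show ?thesis
    by simp
qed

lemma \<theta>_pos:
  assumes "\<And>p. p \<in> P \<Longrightarrow> prime p"
  shows "\<theta> P > 0"
  unfolding \<theta>_def
proof (rule prod_pos)
  fix p assume "p \<in> P"
  then have "p > 1"
    using assms prime_gt_1_nat by blast
  then show "0 < 1 - 1 / real p"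
    by simp
qed

lemma \<theta>_insert: "finite P \<Longrightarrow> p \<notin> P \<Longrightarrow> \<theta> (insert p P) = (1 - 1 / real p) * \<theta> P"
  by (simp add: \<theta>_def)

text \<open>The new subsets are those containing \<open>p\<close>. If \<open>p\<close> divides
  \<open>Q\<close>, they repeat the old costs; otherwise every one of them costs the full 2.\<close>

lemma E_insert:
  assumes "finite P" "p \<notin> P"
  shows "E (insert p P) = E P + (if p dvd Q then E P else 2 * 2 ^ card P)"
proof -
  have "over_Q (insert p P) = (if p dvd Q then insert p (over_Q P) else over_Q P)"
    by (auto simp: over_Q_def)
  moreover have "finite (over_Q P)" "p \<notin> over_Q P"
    using assms by (auto simp: over_Q_def)
  ultimately show ?thesis
    using assms by (simp add: E_def algebra_simps)
qed

section \<open>Inserting one prime: characters of order dividing \<open>p\<close> and bounds for the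
  twisted sums\<close>

lemma sum_chi_p:
  assumes "p dvd L" "p > 0" "x \<noteq> 0"
  shows "(\<Sum>a<p. chi (a * (L div p)) x) = (if p dvd dlog x then of_nat p else 0)"
proof -
  define w where "w = \<omega> ^ (L div p * dlog x)"
  have chi: "chi (a * (L div p)) x = w ^ a" for a
    using assms(3) by (simp add: chi_def w_def power_mult[symmetric] mult_ac)
  have L: "L = L div p * p"
    using assms(1) by simp
  have "L div p > 0"
    using L L_pos by (metis mult_0 neq0_conv)
  then have w1: "w = 1 \<longleftrightarrow> p dvd dlog x"
    unfolding w_def \<omega>_power_eq_1_iff by (subst L) simp
  have "w ^ p = \<omega> ^ (L div p * p * dlog x)"
    by (simp add: w_def power_mult[symmetric] mult_ac)
  then have wp: "w ^ p = 1"
    unfolding L[symmetric] by (simp add: \<omega>_power_eq_1_iff)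
  show ?thesis
  proof (cases "w = 1")
    case True
    then show ?thesis
      using w1 by (simp add: chi)
  next
    case False
    then have "(\<Sum>a<p. w ^ a) = 0"
      using geometric_sum[OF False, of p] wp by simp
    then show ?thesis
      using False w1 by (simp add: chi)
  qed
qed

text \<open>The indicator of \<open>p\<close> not dividing \<open>dlog x\<close> is 1 minus the
  average of the \<open>p\<close> characters of order dividing \<open>p\<close>; the term
  \<open>a = 0\<close> merges into the factor \<open>1 - 1 / p\<close>.\<close>

lemma A_insert:
  assumes "p dvd L" "p > 0"
  shows "A (insert p P) j
    = (1 - 1 / of_nat p) * A P j - (1 / of_nat p) * (\<Sum>a\<in>{1..<p}. A P (j + a * (L div p)))"
proof -
  have Zins: "Z (insert p P) = {x\<in>Z P. \<not> p dvd dlog x}"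
    by (auto simp: Z_def)
  have "A (insert p P) j = (\<Sum>x\<in>Z P. if p dvd dlog x then 0 else chi j x)"
    unfolding A_def Zins by (subst sum.inter_filter) (auto intro!: sum.cong)
  also have "\<dots> = (\<Sum>x\<in>Z P. chi j x - (1 / of_nat p) * (\<Sum>a<p. chi (j + a * (L div p)) x))"
  proof (rule sum.cong[OF refl])
    fix x assume "x \<in> Z P"
    then have "x \<noteq> 0"
      by (rule Z_nonzero)
    then show "(if p dvd dlog x then 0 else chi j x)
        = chi j x - (1 / of_nat p) * (\<Sum>a<p. chi (j + a * (L div p)) x)"
      unfolding chi_add sum_distrib_left[symmetric] using sum_chi_p[OF assms] assms(2) by simp
  qed
  also have "\<dots> = A P j - (1 / of_nat p) * (\<Sum>a<p. A P (j + a * (L div p)))"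
    unfolding A_def sum_subtractf sum_distrib_left[symmetric] by (subst sum.swap) simp
  also have "(\<Sum>a<p. A P (j + a * (L div p))) = A P j + (\<Sum>a\<in>{1..<p}. A P (j + a * (L div p)))"
    using assms(2) sum.atLeast_Suc_lessThan[of 0 p "\<lambda>a. A P (j + a * (L div p))"]
    by (simp add: lessThan_atLeast0)
  finally show ?thesis
    by (simp add: algebra_simps)
qed

text \<open>For \<open>p = 2\<close> this uses that 4 divides \<open>L\<close>. It keeps all shifted
  indices even, as the bounds on \<open>S\<close> require.\<close>

lemma even_L_div_prime:
  assumes "prime p" "p dvd L"
  shows "even (L div p)"
proof (cases "p = 2")
  case True
  then show ?thesis
    using four_dvd_L by (auto elim!: dvdE)
next
  case False
  then have "odd p"
    using assms(1) primes_dvd_imp_eq two_is_prime_nat by blast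
  moreover have "even (p * (L div p))"
    using assms(2) by simp
  ultimately show ?thesis
    by simp
qed

lemma norm_A_step:
  assumes "p dvd L" "p > 0" "norm (A P j) \<le> B"
    and "\<And>a. a \<in> {1..<p} \<Longrightarrow> norm (A P (j + a * (L div p))) \<le> B'"
  shows "norm (A (insert p P) j) \<le> (1 - 1 / real p) * (B + B')"
proof -
  have "norm ((1 - 1 / of_nat p) * A P j) = (1 - 1 / real p) * norm (A P j)"
  proof -
    have "(1 - 1 / of_nat p :: complex) = of_real (1 - 1 / real p)"
      by simp
    moreover have "1 - 1 / real p \<ge> 0"
      using assms(2) by simp
    ultimately show ?thesis
      by (simp only: norm_mult norm_of_real abs_of_nonneg)
  qed
  also have "\<dots> \<le> (1 - 1 / real p) * B"
    using assms(2,3) by (intro mult_left_mono) auto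
  finally have 1: "norm ((1 - 1 / of_nat p) * A P j) \<le> (1 - 1 / real p) * B" .
  have "norm ((1 / of_nat p) * (\<Sum>a\<in>{1..<p}. A P (j + a * (L div p)))) \<le> (1 - 1 / real p) * B'"
    using assms(2,4) by (rule norm_avg_le)
  then show ?thesis
    unfolding A_insert[OF assms(1,2)] distrib_left
    using 1 norm_triangle_ineq4 order.trans add_mono by meson
qed

text \<open>\<open>M\<close> is a certificate of nontriviality of the character \<open>j\<close> that is preserved by the shifts
  \<open>j + a L / p\<close> coming from \<open>A_insert\<close>; for a character of prime order it is the corresponding prime power part of \<open>L\<close>.\<close>

lemma norm_A_nontrivial:
  assumes "L_primes P" "M dvd L" "\<And>p. p \<in> P \<Longrightarrow> M dvd L div p" "\<not> M dvd j" "even j"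
  shows "norm (A P j) \<le> \<theta> P * X * (2 * 2 ^ card P)"
proof -
  have "finite P"
    using assms(1) by simp
  then show ?thesis
    using assms
  proof (induction P arbitrary: j rule: finite_induct)
    case empty
    then have "\<not> L dvd j"
      using dvd_trans by blast
    then show ?case
      using empty S_nontrivial by (simp add: A_empty \<theta>_def mult.commute)
  next
    case (insert p P)
    have p: "prime p" "p dvd L" "M dvd L div p"
      using insert.prems by auto
    have "norm (A (insert p P) j)
        \<le> (1 - 1 / real p) * (\<theta> P * X * (2 * 2 ^ card P) + \<theta> P * X * (2 * 2 ^ card P))"
    proof (rule norm_A_step)
      show "norm (A P j) \<le> \<theta> P * X * (2 * 2 ^ card P)"
        using insert.prems by (intro insert.IH) auto
      fix a
      have "\<not> M dvd j + a * (L div p)"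
        using insert.prems(4) p(3) by (simp add: dvd_add_left_iff)
      moreover have "even (j + a * (L div p))"
        using insert.prems(5) even_L_div_prime[OF p(1,2)] by simp
      ultimately show "norm (A P (j + a * (L div p))) \<le> \<theta> P * X * (2 * 2 ^ card P)"
        using insert.prems by (intro insert.IH) auto
    qed (use p prime_gt_0_nat in auto)
    then show ?case
      using insert.hyps by (simp add: \<theta>_insert algebra_simps)
  qed
qed

text \<open>\<open>M\<close> is the exact power of \<open>p\<close> in \<open>L\<close>. For
  \<open>0 < a < p\<close> the number \<open>a * (L div p)\<close> lacks one factor
  \<open>p\<close>, while dividing \<open>L\<close> by another prime removes none. If
  \<open>p\<close> does not divide \<open>Q\<close>, the whole power sits in
  \<open>q - 1\<close>.\<close>

lemma prime_part_of_L:
  assumes "prime p" "p dvd L"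
  obtains M where "M dvd L" "\<And>p'. prime p' \<Longrightarrow> p' dvd L \<Longrightarrow> p' \<noteq> p \<Longrightarrow> M dvd L div p'"
    "\<And>a. a \<in> {1..<p} \<Longrightarrow> \<not> M dvd a * (L div p)" "\<not> p dvd Q \<Longrightarrow> M dvd q - 1"
proof -
  obtain v w where vw: "\<not> p dvd w" "L = w * p ^ v"
    using prime_power_canonical[OF assms(1) L_pos] by blast
  obtain v' where v': "v = Suc v'"
    using vw assms(2) by (cases v) auto
  have p0: "p > 0"
    using assms(1) prime_gt_0_nat by blast
  show thesis
  proof (rule that[of "p ^ v"])
    show "p ^ v dvd L"
      using vw by simp
    fix p' assume p': "prime p'" "p' dvd L" "p' \<noteq> p"
    have "p ^ v dvd p' * (L div p')"
      using p' vw by simp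
    moreover have "coprime (p ^ v) p'"
      using p' assms(1) by (simp add: primes_coprime)
    ultimately show "p ^ v dvd L div p'"
      by (simp add: coprime_dvd_mult_right_iff)
  next
    fix a assume a: "a \<in> {1..<p}"
    have "L div p = w * p ^ v'"
      using vw v' p0 by simp
    moreover have "\<not> p dvd a * w"
      using a vw(1) assms(1) by (auto simp: prime_dvd_mult_iff dest: dvd_imp_le)
    ultimately show "\<not> p ^ v dvd a * (L div p)"
      using p0 by (simp add: v' mult.assoc[symmetric])
  next
    assume "\<not> p dvd Q"
    then have "coprime (p ^ v) Q"
      using assms(1) by (simp add: prime_imp_coprime)
    moreover have "p ^ v dvd Q * (q - 1)"
      using vw(2) unfolding L_eq[symmetric] by simp
    ultimately show "p ^ v dvd q - 1"
      by (simp add: coprime_dvd_mult_right_iff)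
  qed
qed

text \<open>A shift by \<open>a * (L div p)\<close> with \<open>p\<close> dividing \<open>Q\<close>
  preserves divisibility by \<open>q - 1\<close>, so the induction hypothesis applies. For other
  \<open>p\<close> the shifted sums get only the general bound, matching the two cases of
  \<open>E_insert\<close>.\<close>

lemma norm_A_trivial_on_F:
  assumes "L_primes P" "M dvd L" "\<And>p. p \<in> P \<Longrightarrow> M dvd L div p" "\<not> M dvd j" "even j" "q - 1 dvd j"
  shows "norm (A P j) \<le> \<theta> P * X * E P"
proof -
  have "finite P"
    using assms(1) by simp
  then show ?thesis
    using assms
  proof (induction P arbitrary: j rule: finite_induct)
    case empty
    then have "\<not> L dvd j"
      using dvd_trans by blast
    then show ?case
      using empty S_trivial_on_F[of j]
      by (simp add: A_empty \<theta>_def E_def over_Q_def c_def mult.commute)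
  next
    case (insert p P)
    have p: "prime p" "p dvd L" "M dvd L div p"
      using insert.prems by auto
    have p0: "p > 0"
      using p prime_gt_0_nat by blast
    have even: "even (j + a * (L div p))" for a
      using insert.prems(5) even_L_div_prime[OF p(1,2)] by simp
    have IH: "norm (A P i) \<le> \<theta> P * X * E P" if "\<not> M dvd i" "even i" "q - 1 dvd i" for i
      using insert.prems that by (intro insert.IH) auto
    have "norm (A (insert p P) j) \<le> (1 - 1 / real p)
        * (\<theta> P * X * E P + \<theta> P * X * (if p dvd Q then E P else 2 * 2 ^ card P))"
    proof (rule norm_A_step[OF p(2) p0])
      show "norm (A P j) \<le> \<theta> P * X * E P"
        using insert.prems by (intro IH) auto
      fix a assume a: "a \<in> {1..<p}"
      show "norm (A P (j + a * (L div p)))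
          \<le> \<theta> P * X * (if p dvd Q then E P else 2 * 2 ^ card P)"
      proof (cases "p dvd Q")
        case True
        then have "L div p = Q div p * (q - 1)"
          using L_eq by (simp add: dvd_div_mult)
        then have "q - 1 dvd j + a * (L div p)"
          using insert.prems(6) by simp
        moreover have "\<not> M dvd j + a * (L div p)"
          using insert.prems(4) p(3) by (simp add: dvd_add_left_iff)
        ultimately show ?thesis
          using True IH even by simp
      next
        case False
        obtain M' where M': "M' dvd L" "\<And>p'. prime p' \<Longrightarrow> p' dvd L \<Longrightarrow> p' \<noteq> p \<Longrightarrow> M' dvd L div p'"
          "\<not> M' dvd a * (L div p)" "M' dvd q - 1"
          using prime_part_of_L[OF p(1,2)] a False by metis
        \<comment> \<open>The old certificate is replaced by the \<open>p\<close>-part of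
          \<open>L\<close>: it divides \<open>q - 1\<close> and hence \<open>j\<close>, but not the
          shift.\<close>
        have "\<not> M' dvd j + a * (L div p)"
          using M'(3,4) insert.prems(6) dvd_trans by (metis dvd_add_right_iff)
        moreover have "M' dvd L div p'" if "p' \<in> P" for p'
          using insert.prems(1) insert.hyps(2) that by (intro M'(2)) auto
        ultimately show ?thesis
          using False insert.prems(1) M'(1) even norm_A_nontrivial[of P M'] by simp
      qed
    qed
    then show ?case
      unfolding \<theta>_insert[OF insert.hyps] E_insert[OF insert.hyps]
      by (simp only: distrib_left mult.assoc)
  qed
qed

lemma norm_A_twist:
  assumes "L_primes P" "prime p" "p dvd L" "p \<notin> P" "a \<in> {1..<p}"
  shows "norm (A P (a * (L div p))) \<le> \<theta> P * X * (if p dvd Q then E P else 2 * 2 ^ card P)"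
proof -
  obtain M where M: "M dvd L" "\<And>p'. prime p' \<Longrightarrow> p' dvd L \<Longrightarrow> p' \<noteq> p \<Longrightarrow> M dvd L div p'"
    "\<not> M dvd a * (L div p)"
    using prime_part_of_L[OF assms(2,3)] assms(5) by metis
  have M_P: "M dvd L div p'" if "p' \<in> P" for p'
    using assms(1,4) that by (intro M(2)) auto
  have even: "even (a * (L div p))"
    using even_L_div_prime[OF assms(2,3)] by simp
  show ?thesis
  proof (cases "p dvd Q")
    case True
    then have "L div p = Q div p * (q - 1)"
      using L_eq by (simp add: dvd_div_mult)
    then have "q - 1 dvd a * (L div p)"
      by simp
    then show ?thesis
      using True norm_A_trivial_on_F[OF assms(1) M(1) M_P M(3) even] by simp
  next
    case False
    then show ?thesis
      using norm_A_nontrivial[OF assms(1) M(1) M_P M(3) even] by simp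
  qed
qed

text \<open>Comparing with \<open>(1 - 1 / p)\<close> times the old count cancels the principal
  term, so only sums twisted by characters of order \<open>p\<close> remain. This is sharper than
  subtracting two instances of \<open>card_Z\<close>.\<close>

lemma card_Z_insert:
  assumes "L_primes P" "prime p" "p dvd L" "p \<notin> P"
  shows "\<bar>real (card (Z (insert p P))) - (1 - 1 / real p) * real (card (Z P))\<bar>
    \<le> (1 - 1 / real p) * (\<theta> P * X * (if p dvd Q then E P else 2 * 2 ^ card P))"
proof -
  have p0: "p > 0"
    using assms(2) prime_gt_0_nat by blast
  have "complex_of_real (real (card (Z (insert p P))) - (1 - 1 / real p) * real (card (Z P)))
      = - ((1 / of_nat p) * (\<Sum>a\<in>{1..<p}. A P (a * (L div p))))"
    using A_insert[OF assms(3) p0, of P 0] by (simp add: A_0)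
  then have "\<bar>real (card (Z (insert p P))) - (1 - 1 / real p) * real (card (Z P))\<bar>
      = norm ((1 / of_nat p) * (\<Sum>a\<in>{1..<p}. A P (a * (L div p))))"
    by (metis norm_minus_cancel norm_of_real)
  also have "\<dots> \<le> (1 - 1 / real p) * (\<theta> P * X * (if p dvd Q then E P else 2 * 2 ^ card P))"
    using p0 norm_A_twist[OF assms] by (rule norm_avg_le)
  finally show ?thesis .
qed

lemma card_Z:
  assumes "L_primes P"
  shows "\<bar>real (card (Z P)) - \<theta> P * X\<^sup>2\<bar> \<le> \<theta> P * X * E P"
proof -
  have "finite P"
    using assms by simp
  then show ?thesis
    using assms
  proof (induction P rule: finite_induct)
    case empty
    have "complex_of_real (real (card (Z {})) - X\<^sup>2) = S 0 - of_real (X\<^sup>2)"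
      using A_0[of "{}"] A_empty by simp
    then have "\<bar>real (card (Z {})) - X\<^sup>2\<bar> \<le> X"
      using S_principal by (metis norm_of_real)
    \<comment> \<open>The bound is relaxed to \<open>X * E {}\<close>, since
      \<open>2 - c = 1 + 1 / sqrt q\<close>.\<close>
    also have "X \<le> (1 + 1 / sqrt q) * X"
      using X_pos by (simp add: distrib_right)
    finally show ?case
      by (simp add: \<theta>_def E_def over_Q_def c_def mult.commute)
  next
    case (insert p P)
    let ?N = "real (card (Z P))" and ?t = "1 - 1 / real p"
    have p: "prime p" "p dvd L"
      using insert.prems by auto
    then have t: "?t \<ge> 0"
      using prime_gt_0_nat[of p] by simp
    have "\<bar>?t * ?N - ?t * (\<theta> P * X\<^sup>2)\<bar> = ?t * \<bar>?N - \<theta> P * X\<^sup>2\<bar>"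
      using t by (simp only: right_diff_distrib[symmetric] abs_mult abs_of_nonneg)
    also have "\<dots> \<le> ?t * (\<theta> P * X * E P)"
      using t insert by (intro mult_left_mono) auto
    finally have "\<bar>real (card (Z (insert p P))) - ?t * (\<theta> P * X\<^sup>2)\<bar>
        \<le> ?t * (\<theta> P * X * E P) + ?t * (\<theta> P * X * (if p dvd Q then E P else 2 * 2 ^ card P))"
      using card_Z_insert[OF _ p insert.hyps(2)] insert.prems by auto
    then show ?case
      unfolding \<theta>_insert[OF insert.hyps] E_insert[OF insert.hyps]
      by (simp only: distrib_left mult.assoc)
  qed
qed

text \<open>A union bound: an element of \<open>Z P\<close> lost in \<open>Z (P \<union> I)\<close>
  fails at some \<open>p\<close> in \<open>I\<close>. The result is regrouped around the expected
  counts so that \<open>card_Z_insert\<close> applies to each difference.\<close>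

lemma sieve:
  assumes "finite I"
  shows "real (card (Z (P \<union> I)))
    \<ge> (1 - (\<Sum>p\<in>I. 1 / real p)) * real (card (Z P))
      + (\<Sum>p\<in>I. real (card (Z (insert p P))) - (1 - 1 / real p) * real (card (Z P)))"
proof -
  have sub: "Z (insert p P) \<subseteq> Z P" for p
    by (auto simp: Z_def)
  have "Z P \<subseteq> Z (P \<union> I) \<union> (\<Union>p\<in>I. Z P - Z (insert p P))"
    by (auto simp: Z_def)
  then have "card (Z P) \<le> card (Z (P \<union> I) \<union> (\<Union>p\<in>I. Z P - Z (insert p P)))"
    by (intro card_mono) auto
  also have "\<dots> \<le> card (Z (P \<union> I)) + card (\<Union>p\<in>I. Z P - Z (insert p P))"
    by (rule card_Un_le)
  also have "card (\<Union>p\<in>I. Z P - Z (insert p P)) \<le> (\<Sum>p\<in>I. card (Z P - Z (insert p P)))"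
    using assms by (rule card_UN_le)
  finally have "real (card (Z P))
      \<le> real (card (Z (P \<union> I))) + (\<Sum>p\<in>I. real (card (Z P - Z (insert p P))))"
    by (simp flip: of_nat_sum of_nat_add)
  also have "(\<Sum>p\<in>I. real (card (Z P - Z (insert p P))))
      = (\<Sum>p\<in>I. real (card (Z P)) - real (card (Z (insert p P))))"
    using sub by (intro sum.cong) (auto simp: card_Diff_subset of_nat_diff card_mono)
  finally show ?thesis
    by (simp add: sum_subtractf sum.distrib left_diff_distrib sum_distrib_right)
qed

lemma sieve_criterion:
  assumes "L_primes (P \<union> I)" "P \<inter> I = {}"
    and \<delta>: "\<delta> = 1 - (\<Sum>p\<in>I. 1 / real p)" "\<delta> > 0"
    and bound: "X > 2 * 2 ^ card P * (1 + (\<Sum>p\<in>I. 1 - 1 / real p) / \<delta>)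
      - c * 2 ^ card (over_Q P) * (1 + (\<Sum>p\<in>over_Q I. 1 - 1 / real p) / \<delta>)"
  shows "card (Z (P \<union> I)) > 0"
proof -
  define t where "t p = 1 - 1 / real p" for p :: nat
  define U V where "U = (2 * 2 ^ card P :: real)" and "V = c * 2 ^ card (over_Q P)"
  define w where "w p = (if p dvd Q then U - V else U)" for p
  have P: "L_primes P" and fin: "finite I"
    using assms(1) by auto
  have \<theta>: "\<theta> P > 0"
    using P by (intro \<theta>_pos) auto
  have E: "E P = U - V"
    by (simp add: E_def U_def V_def)
  have "(\<Sum>p\<in>I. t p * w p) = (\<Sum>p\<in>I. t p * U - (if p dvd Q then t p * V else 0))"
    by (intro sum.cong) (auto simp: w_def right_diff_distrib)
  also have "\<dots> = sum t I * U - sum t (over_Q I) * V"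
    using fin by (simp add: sum_subtractf over_Q_def sum_distrib_right flip: sum.inter_filter)
  finally have sum_w: "(\<Sum>p\<in>I. t p * w p) = sum t I * U - sum t (over_Q I) * V" .
  have "(\<Sum>p\<in>I. - (\<theta> P * X * (t p * w p)))
      \<le> (\<Sum>p\<in>I. real (card (Z (insert p P))) - t p * real (card (Z P)))"
  proof (rule sum_mono)
    fix p assume "p \<in> I"
    then have "prime p" "p dvd L" "p \<notin> P"
      using assms(1,2) by auto
    then have "\<bar>real (card (Z (insert p P))) - t p * real (card (Z P))\<bar> \<le> t p * (\<theta> P * X * w p)"
      using card_Z_insert[OF P, of p] unfolding E t_def w_def U_def[symmetric] by simp
    moreover have "t p * (\<theta> P * X * w p) = \<theta> P * X * (t p * w p)"
      by simp
    ultimately show "- (\<theta> P * X * (t p * w p))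
        \<le> real (card (Z (insert p P))) - t p * real (card (Z P))"
      by linarith
  qed
  moreover have "(\<Sum>p\<in>I. - (\<theta> P * X * (t p * w p)))
      = - (\<theta> P * X * (sum t I * U - sum t (over_Q I) * V))"
    unfolding sum_w[symmetric] by (simp add: sum_negf sum_distrib_left)
  moreover have "\<delta> * (\<theta> P * X\<^sup>2 - \<theta> P * X * (U - V)) \<le> \<delta> * real (card (Z P))"
    using card_Z[OF P] \<delta>(2) unfolding E by (intro mult_left_mono) auto
  ultimately have "real (card (Z (P \<union> I))) \<ge> \<delta> * (\<theta> P * X\<^sup>2 - \<theta> P * X * (U - V))
      - \<theta> P * X * (sum t I * U - sum t (over_Q I) * V)"
    using sieve[OF fin, of P] unfolding \<delta>(1)[symmetric] t_def[symmetric] by linarith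
  \<comment> \<open>Factoring out the positive \<open>\<theta> P * X * \<delta>\<close> leaves
    exactly the difference of the two sides of \<open>bound\<close>.\<close>
  moreover have "\<delta> * (\<theta> P * X\<^sup>2 - \<theta> P * X * (U - V))
      - \<theta> P * X * (sum t I * U - sum t (over_Q I) * V)
      = \<theta> P * X * \<delta> * (X - (U * (1 + sum t I / \<delta>) - V * (1 + sum t (over_Q I) / \<delta>)))"
    using \<delta>(2) by (simp add: field_simps power2_eq_square)
  moreover have "\<theta> P * X * \<delta> * (X - (U * (1 + sum t I / \<delta>) - V * (1 + sum t (over_Q I) / \<delta>))) > 0"
    using \<theta> X_pos \<delta>(2) bound unfolding U_def V_def t_def by (intro mult_pos_pos) auto
  ultimately show ?thesis
    by simp
qed

text \<open>If \<open>x = z ^ d\<close> with \<open>d > 1\<close> dividing \<open>L\<close>, any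
  prime factor of \<open>d\<close> divides both \<open>d * dlog z\<close> and \<open>L\<close>, so
  it survives reduction modulo \<open>L\<close>.\<close>

lemma m_free_of_dlog:
  assumes "x \<noteq> 0" "\<And>p. p \<in> prime_factors L \<Longrightarrow> \<not> p dvd dlog x"
  shows "m_free L x"
  unfolding m_free_def
proof (intro conjI allI impI)
  fix d z assume dz: "d dvd L \<and> z \<noteq> 0 \<and> x = z ^ d"
  show "d = 1"
  proof (rule ccontr)
    assume "d \<noteq> 1"
    then obtain p where p: "prime p" "p dvd d"
      using prime_factor_nat by blast
    have "dlog x = (d * dlog z) mod L"
      using dz dlog_power by simp
    moreover have "p dvd L"
      using p dz dvd_trans by blast
    ultimately have "p dvd dlog x"
      using p by (simp add: dvd_mod_iff)
    moreover have "p \<in> prime_factors L"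
      using p \<open>p dvd L\<close> L_pos by (simp add: prime_factors_dvd)
    ultimately show False
      using assms(2) by blast
  qed
qed (fact assms(1))

lemma N_free_pos:
  assumes "card (Z (prime_factors L)) > 0"
  shows "N_free q n \<beta> L > 0"
proof -
  have "Z (prime_factors L) \<noteq> {}"
    using assms by auto
  then obtain x where x: "x \<in> Z (prime_factors L)"
    by blast
  then have "m_free L x"
    using Z_nonzero by (intro m_free_of_dlog) (auto simp: Z_def)
  then show ?thesis
    using x unfolding N_free_def by (auto simp: card_gt_0_iff Z_def)
qed

end

section \<open>Numerical criteria\<close>

lemma prime_factors_prod_primes:
  fixes S :: "nat set"
  assumes "finite S" "\<And>p. p \<in> S \<Longrightarrow> prime p"
  shows "prime_factors (\<Prod>S) = S"
proof -
  have "0 \<notin> (\<lambda>p. p) ` S"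
    using assms(2)[of 0] by auto
  then have "prime_factors (\<Prod>S) = (\<Union>p\<in>S. prime_factors p)"
    using prime_factors_prod[OF assms(1), of "\<lambda>p. p"] by (simp add: comp_def)
  also have "\<dots> = S"
    using assms(2) by (auto simp: prime_prime_factors)
  finally show ?thesis .
qed

lemma squarefree_eq_prod_prime_factors:
  fixes d :: nat
  assumes "squarefree d"
  shows "d = \<Prod>(prime_factors d)"
proof -
  have "d \<noteq> 0"
    using assms by (metis not_squarefree_0)
  then have "d = (\<Prod>p\<in>prime_factors d. p ^ multiplicity p d)"
    using prime_factorization_nat[of d] by simp
  also have "\<dots> = \<Prod>(prime_factors d)"
    using assms \<open>d \<noteq> 0\<close> by (intro prod.cong) (auto simp: squarefree_factorial_semiring')
  finally show ?thesis .
qed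

lemma prod_prime_factors_subset_dvd:
  fixes t :: nat
  assumes "t > 0" "S \<subseteq> prime_factors t"
  shows "\<Prod>S dvd t"
proof -
  have "\<Prod>S dvd \<Prod>(prime_factors t)"
    using assms(2) by (intro prod_dvd_prod_subset) auto
  also have "\<dots> dvd (\<Prod>p\<in>prime_factors t. p ^ multiplicity p t)"
    using assms(1) by (intro prod_dvd_prod) (auto simp: prime_factors_multiplicity)
  also have "\<dots> = t"
    using prime_factorization_nat[of t] assms(1) by simp
  finally show ?thesis .
qed

lemma W_sqfree_eq:
  assumes "t > 0"
  shows "W_sqfree t = 2 ^ card (prime_factors t)"
proof -
  have "bij_betw prime_factors {d. d dvd t \<and> squarefree d} (Pow (prime_factors t))"
  proof (rule bij_betwI[where g = "\<lambda>S. \<Prod>S"])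
    show "prime_factors \<in> {d. d dvd t \<and> squarefree d} \<rightarrow> Pow (prime_factors t)"
      using assms by (auto dest: dvd_prime_factors[rotated])
    show "Prod \<in> Pow (prime_factors t) \<rightarrow> {d. d dvd t \<and> squarefree d}"
    proof
      fix S assume S: "S \<in> Pow (prime_factors t)"
      have "squarefree (\<Prod>p\<in>S. p)"
        using S by (intro squarefree_prod_coprime)
          (auto intro!: squarefree_prime primes_coprime)
      then show "\<Prod>S \<in> {d. d dvd t \<and> squarefree d}"
        using S prod_prime_factors_subset_dvd[OF assms] by auto
    qed
    show "\<Prod>(prime_factors d) = d" if "d \<in> {d. d dvd t \<and> squarefree d}" for d
      using that squarefree_eq_prod_prime_factors by auto
    show "prime_factors (\<Prod>S) = S" if "S \<in> Pow (prime_factors t)" for S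
      using that by (intro prime_factors_prod_primes) (auto intro: finite_subset)
  qed
  then have "card {d. d dvd t \<and> squarefree d} = card (Pow (prime_factors t))"
    by (rule bij_betw_same_card)
  then show ?thesis
    by (simp add: W_sqfree_def card_Pow)
qed

text \<open>The order of 5 is 2 modulo 3 and 6 modulo 7, so no odd power of 5 is 1 there, and
  \<open>p = 5\<close> is impossible. The recursion on \<open>5 * 25 ^ h\<close> tracks these
  residues.\<close>

lemma prime_dvd_5_power_odd:
  assumes "prime p" "p dvd 5 ^ (2 * h + 1) - 1" "p \<noteq> 2"
  shows "p \<ge> (11::nat)"
proof (rule ccontr)
  assume "\<not> p \<ge> 11"
  moreover have "odd p"
    using assms(1,3) prime_odd_nat[of p] prime_ge_2_nat[of p] by linarith
  moreover have "p \<noteq> 1" "p \<noteq> 9"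
    using assms(1) primes_dvd_imp_eq[of 3 9] by (auto intro: notI)
  ultimately have p: "p = 3 \<or> p = 5 \<or> p = 7"
    by presburger
  have step: "(5 * 25 ^ Suc h) mod l = (25 * ((5 * 25 ^ h) mod l)) mod l" for h l :: nat
    by (simp add: mod_mult_right_eq mult.left_commute)
  have mod3: "(5 * 25 ^ h) mod 3 = (2::nat)"
    by (induction h) (simp_all only: step, simp_all)
  have mod7: "(5 * 25 ^ h) mod 7 \<in> {3, 5, 6::nat}"
  proof (induction h)
    case (Suc h)
    then show ?case
      unfolding step by auto
  qed simp
  have pow: "5 ^ (2 * h + 1) = (5 * 25 ^ h :: nat)"
    by (simp add: power_mult)
  have ge: "(5 * 25 ^ h :: nat) \<ge> 5"
    by simp
  have "(5 * 25 ^ h) mod p = 1 mod p"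
    using assms(2) ge unfolding pow by (subst mod_eq_dvd_iff_nat) auto
  then show False
    using p mod3 mod7 by auto
qed

context square_trace begin

text \<open>The value 1/2 serves \<open>q = 5\<close>. The value 2/3 makes
  \<open>2 - c \<le> 4/3 \<le> sqrt 2\<close>, which is what \<open>q \<ge> 9\<close> needs.\<close>

lemma c_bounds: "c \<ge> 1/2" "q \<ge> 9 \<Longrightarrow> c \<ge> 2/3"
proof -
  have "q mod 4 = 1"
    using q_cong by (simp add: cong_def)
  then have "q \<ge> 4"
    using q_gt_1 by presburger
  then have "sqrt q \<ge> 2"
    by (simp add: real_le_rsqrt)
  then have "1 / sqrt q \<le> 1 / 2"
    using \<open>q \<ge> 4\<close> by (intro divide_left_mono) auto
  then show "c \<ge> 1/2"
    by (simp add: c_def)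
  assume "q \<ge> 9"
  then have "sqrt q \<ge> 3"
    by (simp add: real_le_rsqrt)
  then have "1 / sqrt q \<le> 1 / 3"
    using \<open>q \<ge> 4\<close> by (intro divide_left_mono) auto
  then show "c \<ge> 2/3"
    by (simp add: c_def)
qed

text \<open>For \<open>q = 5\<close> the bound \<open>2 - c = 1 + 1 / \<surd>5\<close> exceeds \<open>\<surd>2\<close>, so the stated inequality does not give
  the criterion. Here the only prime of \<open>L\<close> outside \<open>Q\<close> is \<open>2\<close> and the others are at least \<open>11\<close>,
  which makes the criterion without sieving primes true for every \<open>n \<ge> 5\<close>.\<close>

lemma N_free_pos_q5:
  assumes "q = 5" "h \<ge> 2"
  shows "N_free q n \<beta> L > 0"
proof -
  let ?P = "prime_factors L"
  define m where "m = card (over_Q ?P)"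
  have L4: "L = Q * 4"
    using L_eq assms by simp
  have two: "2 \<in> ?P"
    using L_pos by (simp add: prime_factors_dvd)
  have over: "over_Q ?P = ?P - {2}"
  proof -
    have "p dvd Q" if "prime p" "p dvd L" "p \<noteq> 2" for p
    proof -
      have "p dvd Q \<or> p dvd 2 ^ 2"
        using that L4 by (simp add: prime_dvd_mult_iff)
      then show ?thesis
        using that prime_dvd_power primes_dvd_imp_eq two_is_prime_nat by blast
    qed
    then show ?thesis
      using odd_Q by (auto simp: over_Q_def prime_factors_dvd L_pos)
  qed
  have card: "card ?P = m + 1"
    using card_Suc_Diff1[OF _ two] by (simp add: m_def over)
  have Lval: "L = 5 ^ (2 * h + 1) - 1"
    unfolding L_def using assms by (simp add: n_eq)
  have "real 11 ^ m = (\<Prod>p\<in>over_Q ?P. real 11)"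
    by (simp add: m_def)
  also have "\<dots> \<le> (\<Prod>p\<in>over_Q ?P. real p)"
  proof (rule prod_mono)
    fix p assume "p \<in> over_Q ?P"
    then have "prime p" "p dvd L" "p \<noteq> 2"
      unfolding over by auto
    then have "p \<ge> 11"
      using prime_dvd_5_power_odd unfolding Lval by blast
    then show "0 \<le> real 11 \<and> real 11 \<le> real p"
      by simp
  qed
  also have "\<dots> = real (\<Prod>(over_Q ?P))"
    by simp
  also have "\<dots> \<le> real Q"
  proof -
    have "Q > 0"
      using L4 L_pos by simp
    moreover have "over_Q ?P \<subseteq> prime_factors Q"
      using \<open>Q > 0\<close> by (auto simp: over_Q_def prime_factors_dvd)
    ultimately have "\<Prod>(over_Q ?P) dvd Q"
      by (rule prod_prime_factors_subset_dvd)
    then show ?thesis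
      using \<open>Q > 0\<close> by (intro of_nat_mono dvd_imp_le)
  qed
  finally have "4 * 11 ^ m \<le> real L"
    using L4 by simp
  also have "real L < 5 * X\<^sup>2"
  proof -
    have "L < 5 * (5 ^ h)\<^sup>2"
      unfolding Lval by (simp add: power_mult[symmetric] mult.commute)
    then have "real L < real (5 * (5 ^ h)\<^sup>2)"
      by (simp only: of_nat_less_iff)
    then show ?thesis
      unfolding X_def using assms by simp
  qed
  finally have XQ: "4 * 11 ^ m < 5 * X\<^sup>2" .
  \<comment> \<open>Without sieving primes the criterion asks for
    \<open>X > (4 - c) * 2 ^ m\<close>, and \<open>c \<ge> 1/2\<close>. For \<open>m \<le> 2\<close>
    the left side is at most 14, below \<open>5 ^ 2\<close>.\<close>
  have "7/2 * 2 ^ m < X"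
  proof (cases "m \<le> 2")
    case True
    then have "(2::real) ^ m \<le> 2 ^ 2"
      by (intro power_increasing) auto
    moreover have "(5::real) ^ 2 \<le> 5 ^ h"
      using assms by (intro power_increasing) auto
    ultimately show ?thesis
      unfolding X_def using assms by simp
  next
    case False
    then obtain e where e: "m = e + 3"
      using le_Suc_ex[of 3 m] by (auto simp: add.commute)
    \<comment> \<open>After squaring, \<open>XQ\<close> reduces the claim to
      \<open>49 * 4 ^ m \<le> 16/5 * 11 ^ m\<close>; with \<open>m = e + 3\<close> and scaling by
      5/16 the constants become 980 and \<open>11 ^ 3 = 1331\<close>.\<close>
    have "980 * (4::real) ^ e \<le> 1331 * 11 ^ e"
      by (intro mult_mono power_mono) auto
    then have "49 * 4 ^ m \<le> 16 / 5 * (11::real) ^ m"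
      by (simp add: e power_add)
    then have "(7/2 * 2 ^ m)\<^sup>2 < X\<^sup>2"
      using XQ by (simp add: power_mult_distrib power_divide power_mult[symmetric] mult.commute[of m])
        (simp add: power_mult)
    then show ?thesis
      by (rule power2_less_imp_less) (use X_pos in simp)
  qed
  moreover have "1/2 * 2 ^ m \<le> c * 2 ^ m"
    using c_bounds by (intro mult_right_mono) auto
  ultimately have "X > 4 * 2 ^ m - c * 2 ^ m"
    by linarith
  then have "X > 2 * 2 ^ card ?P - c * 2 ^ card (over_Q ?P)"
    by (simp add: card m_def[symmetric])
  then have "card (Z (?P \<union> {})) > 0"
    by (intro sieve_criterion[where \<delta> = 1]) (auto simp: over_Q_def)
  then show ?thesis
    by (intro N_free_pos) simp
qed

lemma criterion_weights_nonneg: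
  assumes "\<delta> > 0"
  shows "0 \<le> (1 + (\<Sum>p\<in>I. 1 - 1 / real p) / \<delta>) * 2 ^ m"
proof -
  have "1 - 1 / real p \<ge> 0" for p
    by (cases "p = 0") auto
  then have "(\<Sum>p\<in>I. 1 - 1 / real p) \<ge> 0"
    by (rule sum_nonneg)
  then show ?thesis
    using assms by (intro mult_nonneg_nonneg add_nonneg_nonneg divide_nonneg_pos) auto
qed

lemma criterion_weights_mono:
  assumes "finite P" "finite I" "\<delta> > 0"
  shows "(1 + (\<Sum>p\<in>over_Q I. 1 - 1 / real p) / \<delta>) * 2 ^ card (over_Q P)
    \<le> (1 + (\<Sum>p\<in>I. 1 - 1 / real p) / \<delta>) * 2 ^ card P"
proof (rule mult_mono)
  have ge0: "1 - 1 / real p \<ge> 0" for p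
    by (cases "p = 0") auto
  have "(\<Sum>p\<in>over_Q I. 1 - 1 / real p) \<le> (\<Sum>p\<in>I. 1 - 1 / real p)"
    using ge0 assms(2) by (intro sum_mono2) (auto simp: over_Q_def)
  then show "1 + (\<Sum>p\<in>over_Q I. 1 - 1 / real p) / \<delta> \<le> 1 + (\<Sum>p\<in>I. 1 - 1 / real p) / \<delta>"
    using assms(3) by (intro add_left_mono divide_right_mono) auto
  show "(2::real) ^ card (over_Q P) \<le> 2 ^ card P"
    using assms(1) by (intro power_increasing card_mono) (auto simp: over_Q_def)
  show "0 \<le> 1 + (\<Sum>p\<in>I. 1 - 1 / real p) / \<delta>"
    using criterion_weights_nonneg[OF assms(3), of I 0] by simp
qed auto

text \<open>The criterion \<open>2 * A - c * B\<close> is at most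
  \<open>sqrt 2 * (2 * A - B)\<close> once
  \<open>(sqrt 2 - c) * B \<le> (2 * sqrt 2 - 2) * A\<close>. As \<open>0 \<le> B \<le> A\<close>,
  this follows from \<open>2 - c \<le> sqrt 2\<close>.\<close>

lemma N_free_pos_q_ge_9:
  assumes "q \<ge> 9" "L_primes (P \<union> I)" "P \<inter> I = {}" "prime_factors L = P \<union> I"
    and \<delta>: "\<delta> = 1 - (\<Sum>p\<in>I. 1 / real p)" "\<delta> > 0"
    and bound: "X > 2 * sqrt 2 * (1 + (\<Sum>p\<in>I. 1 - 1 / real p) / \<delta>) * 2 ^ card P
      - sqrt 2 * (1 + (\<Sum>p\<in>over_Q I. 1 - 1 / real p) / \<delta>) * 2 ^ card (over_Q P)"
  shows "N_free q n \<beta> L > 0"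
proof -
  define A B where "A = (1 + (\<Sum>p\<in>I. 1 - 1 / real p) / \<delta>) * 2 ^ card P"
    and "B = (1 + (\<Sum>p\<in>over_Q I. 1 - 1 / real p) / \<delta>) * 2 ^ card (over_Q P)"
  have "B \<ge> 0"
    unfolding B_def using \<delta>(2) by (rule criterion_weights_nonneg)
  have "B \<le> A"
    unfolding A_def B_def using assms(2) \<delta>(2) by (intro criterion_weights_mono) auto
  have sqrt2: "sqrt 2 \<ge> 4/3"
    by (rule real_le_rsqrt) (simp add: power2_eq_square)
  have "(sqrt 2 - c) * B \<le> (2 * sqrt 2 - 2) * B"
    using sqrt2 c_bounds(2)[OF assms(1)] \<open>B \<ge> 0\<close> by (intro mult_right_mono) auto
  also have "\<dots> \<le> (2 * sqrt 2 - 2) * A"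
    using sqrt2 \<open>B \<le> A\<close> by (intro mult_left_mono) auto
  finally have "2 * A - c * B \<le> 2 * sqrt 2 * A - sqrt 2 * B"
    by (simp add: algebra_simps)
  moreover have "2 * sqrt 2 * A - sqrt 2 * B < X"
    using bound by (simp only: A_def B_def mult.assoc)
  ultimately have "2 * A - c * B < X"
    by linarith
  then have "card (Z (P \<union> I)) > 0"
    using assms by (intro sieve_criterion[of P I \<delta>]) (auto simp only: A_def B_def mult_ac)
  then show ?thesis
    using assms(4) N_free_pos by simp
qed

end

section \<open>Translation into sieve notation and case distinction on \<open>q\<close> and
  \<open>h\<close>\<close>

theorem theorem5p14:
  fixes F :: "'a::{field,finite} set" and \<beta> :: 'a
    and q n k r s Q k_Q :: nat and p :: "nat \<Rightarrow> nat" and \<delta> \<delta>_Q :: real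
  assumes q: "primepow q" "[q = 1] (mod 4)"
    and n: "n \<ge> 3" "odd n"
    and card_field: "CARD('a) = q ^ n"
    and F: "is_subfield F" "card F = q"
    and \<beta>: "\<beta> \<in> F" "\<beta> \<noteq> 0"
    and Q: "Q = (q ^ n - 1) div (q - 1)"
    and radical: "\<Prod>(prime_factors (q ^ n - 1)) = k * (\<Prod>i=1..s. p i)"
    and p_prime: "\<And>i. i \<in> {1..s} \<Longrightarrow> prime (p i)"
    and p_distinct: "inj_on p {1..s}"
    and p_not_dvd: "\<And>i. i \<in> {1..s} \<Longrightarrow> \<not> p i dvd k"
    and rs: "r \<le> s"
    and p_dvd_Q: "\<And>i. i \<in> {1..r} \<Longrightarrow> p i dvd Q"
    and p_not_dvd_Q: "\<And>i. i \<in> {r<..s} \<Longrightarrow> \<not> p i dvd Q"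
    and \<delta>: "\<delta> = 1 - (\<Sum>i=1..s. 1 / real (p i))"
    and \<delta>_Q: "\<delta>_Q = 1 - (\<Sum>i=1..r. 1 / real (p i))"
    and k_Q: "k_Q = \<Prod>{l \<in> prime_factors k. l dvd Q}"
    and \<delta>_pos: "\<delta> > 0"
    and bound: "real q powr ((real n - 1) / 2) >
        2 * sqrt 2 * ((real s - 1) / \<delta> + 2) * real (W_sqfree k)
        - sqrt 2 * ((real r - 1 + \<delta>_Q) / \<delta> + 1) * real (W_sqfree k_Q)"
  shows "N_free q n \<beta> (q ^ n - 1) > 0"
proof -
  obtain g :: 'a where g: "g \<noteq> 0" "\<And>x. x \<noteq> 0 \<Longrightarrow> \<exists>i. x = g ^ i"
    using finite_field_has_generator by blast
  obtain h where h: "n = 2 * h + 1"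
    using n(2) by (elim oddE)
  interpret K: square_trace F q n g \<beta> h
    using q n(1) card_field F \<beta> g h by unfold_locales auto
  have L: "K.L = q ^ n - 1" and KQ: "K.Q = Q"
    by (simp_all add: K.L_def K.Q_def Q)
  define P I where "P = prime_factors k" and "I = p ` {1..s}"
  have primes: "prime x" if "x \<in> I" for x
    using that p_prime by (auto simp: I_def)
  have prod_I: "(\<Prod>i=1..s. p i) = \<Prod>I"
    using p_distinct by (simp add: I_def prod.reindex)
  \<comment> \<open>A product of primes is nonzero, which yields \<open>k > 0\<close> as needed for
    counting squarefree divisors.\<close>
  have "k * \<Prod>I \<noteq> 0"
    unfolding prod_I[symmetric] radical[symmetric] by (auto simp: prime_factors_dvd)
  then have k0: "k > 0" and I0: "\<Prod>I \<noteq> 0"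
    by auto
  have PI: "prime_factors K.L = P \<union> I"
  proof -
    have "prime_factors K.L = prime_factors (\<Prod>(prime_factors K.L))"
      by (rule prime_factors_prod_primes[symmetric]) auto
    also have "\<dots> = prime_factors (k * \<Prod>I)"
      unfolding L radical prod_I ..
    also have "\<dots> = P \<union> I"
      using k0 I0 primes prime_factors_prod_primes[of I]
      by (simp add: prime_factors_product P_def I_def)
    finally show ?thesis .
  qed
  then have L_primes: "finite (P \<union> I) \<and> (\<forall>x\<in>P \<union> I. prime x \<and> x dvd K.L)"
    by (metis finite_set_mset in_prime_factors_imp_dvd in_prime_factors_imp_prime)
  have disj: "P \<inter> I = {}"
    using p_not_dvd by (auto simp: P_def I_def)
  have over_P: "K.over_Q P = {l \<in> prime_factors k. l dvd Q}"
    by (simp add: K.over_Q_def P_def KQ)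
  have over_I: "K.over_Q I = p ` {1..r}"
  proof -
    have "i \<in> {1..r}" if "i \<in> {1..s}" "p i dvd Q" for i
      using that p_not_dvd_Q[of i] by force
    then show ?thesis
      using p_dvd_Q rs by (fastforce simp: K.over_Q_def I_def KQ)
  qed
  have W_k: "W_sqfree k = 2 ^ card P"
    using W_sqfree_eq[OF k0] by (simp add: P_def)
  have "prime_factors k_Q = K.over_Q P"
    unfolding k_Q over_P by (rule prime_factors_prod_primes) auto
  moreover have "k_Q > 0"
    unfolding k_Q by (rule prod_pos) (use in_prime_factors_imp_prime prime_gt_0_nat in blast)
  ultimately have W_kQ: "W_sqfree k_Q = 2 ^ card (K.over_Q P)"
    using W_sqfree_eq by simp
  have inj_r: "inj_on p {1..r}"
    using p_distinct rs by (auto intro: inj_on_subset)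
  have sum_I: "(\<Sum>x\<in>I. 1 / real x) = (\<Sum>i=1..s. 1 / real (p i))"
    unfolding I_def using p_distinct by (simp add: sum.reindex)
  have sum_Ir: "(\<Sum>x\<in>K.over_Q I. 1 / real x) = (\<Sum>i=1..r. 1 / real (p i))"
    unfolding over_I using inj_r by (simp add: sum.reindex)
  have \<delta>': "\<delta> = 1 - (\<Sum>x\<in>I. 1 / real x)"
    by (simp add: \<delta> sum_I)
  \<comment> \<open>Since the reciprocals sum to \<open>1 - \<delta>\<close>, the factor
    \<open>(s - 1) / \<delta> + 2\<close> is the sieve weight of \<open>I\<close>. The primes
    dividing \<open>Q\<close> are treated alike with \<open>\<delta>_Q\<close>, but still divided by
    \<open>\<delta>\<close>.\<close>
  have "(\<Sum>x\<in>I. 1 - 1 / real x) = real s - 1 + \<delta>"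
    using p_distinct unfolding sum_subtractf sum_I \<delta> by (simp add: I_def card_image)
  then have s: "(real s - 1) / \<delta> + 2 = 1 + (\<Sum>x\<in>I. 1 - 1 / real x) / \<delta>"
    using \<delta>_pos by (simp add: field_simps)
  have "(\<Sum>x\<in>K.over_Q I. 1 - 1 / real x) = real r - 1 + \<delta>_Q"
    using inj_r unfolding sum_subtractf sum_Ir \<delta>_Q by (simp add: over_I card_image)
  then have r: "(real r - 1 + \<delta>_Q) / \<delta> + 1 = 1 + (\<Sum>x\<in>K.over_Q I. 1 - 1 / real x) / \<delta>"
    by simp
  have "real q powr ((real n - 1) / 2) = K.X"
    unfolding K.X_def using K.q_gt_1 by (simp add: h powr_realpow)
  then have bound': "K.X > 2 * sqrt 2 * (1 + (\<Sum>x\<in>I. 1 - 1 / real x) / \<delta>) * 2 ^ card P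
      - sqrt 2 * (1 + (\<Sum>x\<in>K.over_Q I. 1 - 1 / real x) / \<delta>) * 2 ^ card (K.over_Q P)"
    using bound unfolding s r W_k W_kQ by simp
  consider "q \<ge> 9" | "q = 5" "h \<ge> 2" | "q = 5" "h = 1"
  proof -
    have "q mod 4 = 1"
      using q(2) by (simp add: cong_def)
    then have "q \<ge> 9 \<or> q = 5"
      using K.q_gt_1 by presburger
    moreover have "h \<ge> 1"
      using n(1) h by simp
    ultimately show thesis
      using that by linarith
  qed
  then have "N_free q n \<beta> K.L > 0"
  proof cases
    case 1
    then show ?thesis
      using L_primes disj PI \<delta>' \<delta>_pos bound' by (rule K.N_free_pos_q_ge_9)
  next
    case 2
    then show ?thesis
      by (rule K.N_free_pos_q5)
  next
    case 3
    txt \<open>For \<open>q ^ n = 125\<close> the assumed inequality is false.\<close>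
    have "K.X = 5"
      unfolding K.X_def using 3 by simp
    have "K.L = 2 * (2 * 31)"
      unfolding K.L_def using 3 by (simp add: h)
    then have "prime_factors K.L = {2, 31}"
      by (simp only: prime_factors_product) (auto simp: prime_prime_factors)
    then have PI': "P \<union> I = {2, 31}"
      using PI by simp
    have "card P + card I = card (P \<union> I)"
      using L_primes disj by (intro card_Un_disjoint[symmetric]) auto
    then have cards: "card P + card I = 2"
      using PI' by simp
    define A B where "A = (1 + (\<Sum>x\<in>I. 1 - 1 / real x) / \<delta>) * 2 ^ card P"
      and "B = (1 + (\<Sum>x\<in>K.over_Q I. 1 - 1 / real x) / \<delta>) * 2 ^ card (K.over_Q P)"
    have "B \<le> A"
      unfolding A_def B_def using L_primes \<delta>_pos by (intro K.criterion_weights_mono) auto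
    have I_s: "card I = s"
      using p_distinct by (simp add: I_def card_image)
    have "A = ((real s - 1) / \<delta> + 2) * 2 ^ card P"
      by (simp add: A_def s)
    moreover consider "s = 0" "card P = 2" | "s = 1" "card P = 1" | "s = 2" "card P = 0"
      using cards I_s by linarith
    \<comment> \<open>The splittings of \<open>{2, 31}\<close> give \<open>1 * 4\<close> for
      \<open>s = 0\<close>, \<open>2 * 2\<close> for \<open>s = 1\<close>, and
      \<open>62/29 + 2\<close> for \<open>s = 2\<close>, where
      \<open>1 - 1/2 - 1/31 = 29/62\<close>.\<close>
    then have "((real s - 1) / \<delta> + 2) * 2 ^ card P \<ge> 4"
    proof cases
      case 1
      then show ?thesis
        by (simp add: \<delta>)
    next
      case 2
      then show ?thesis
        by simp
    next
      case 3
      then have "P = {}"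
        by (simp add: P_def)
      then have "I = {2, 31}"
        using PI' by simp
      then have "\<delta> = 29 / 62"
        unfolding \<delta>' by simp
      then show ?thesis
        using 3 by (simp only: \<open>\<delta> = 29 / 62\<close>) simp
    qed
    ultimately have "A \<ge> 4"
      by simp
    \<comment> \<open>With \<open>A \<ge> 4\<close> this gives
      \<open>sqrt 2 * A \<ge> 5 = X\<close>, contradicting the assumed inequality because
      \<open>B \<le> A\<close>.\<close>
    have "sqrt 2 \<ge> 5/4"
      by (rule real_le_rsqrt) (simp add: power2_eq_square)
    then have "5/4 * 4 \<le> sqrt 2 * A"
      using \<open>A \<ge> 4\<close> by (intro mult_mono) auto
    also have "\<dots> \<le> 2 * sqrt 2 * A - sqrt 2 * B"
      using \<open>B \<le> A\<close> by (simp add: algebra_simps)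
    also have "\<dots> < K.X"
      using bound' by (simp only: A_def B_def mult.assoc)
    finally show ?thesis
      using \<open>K.X = 5\<close> by simp
  qed
  then show ?thesis
    by (simp only: L)
qed

end
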